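(* The group $E_{6(-14),\mathbb C}=\{\alpha\in \mathrm{Iso}_C(\mathfrak J(3,\mathbb C^C)) \mid \det(\alpha X)=\det X,\ \langle\alpha X,\alpha Y\rangle_\sigma=\langle X,Y\rangle_\sigma \text{ for all }X,Y\}$ is isomorphic to the semi-direct product of the groups $(SU(1,2)\times SU(1,2))/\mathbb Z_3$ and $\mathbb Z_2$, where $\mathbb Z_3=\{(E,E),(\boldsymbol\omega E,\boldsymbol\omega E),(\boldsymbol\omega^2E,\boldsymbol\omega^2E)\}$ with $\boldsymbol\omega\in\mathbb C$, $\boldsymbol\omega^3=1$, $\boldsymbol\omega\ne1$, and $\mathbb Z_2=\{1,\varepsilon\}$: $$E_{6(-14),\mathbb C}\cong (SU(1,2)\times SU(1,2))/\mathbb Z_3\rtimes\mathbb Z_2,$$ where $\varepsilon$ acts by $\varepsilon(A,B)=(\overline B,\overline A)$ (descending to the quotient by $\mathbb Z_3$).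
   Context: Two copies of the complex numbers are used: $\mathbb C=\mathbb R\oplus\mathbb R\mathbf i$ (with conjugation $x\mapsto\overline x$) and $C=\mathbb R\oplus\mathbb R i$ (used for complexification). $\mathbb C^C=\mathbb C\otimes_{\mathbb R}C$, with the conjugation of $\mathbb C$ extended $C$-linearly; $A^*={}^t\overline A$ for matrices. $\mathfrak J(3,\mathbb C^C)=\{X\in M(3,\mathbb C^C)\mid X^*=X\}$, a $C$-vector space whose elements are $X=\begin{pmatrix}\xi_1&x_3&\overline x_2\\ \overline x_3&\xi_2&x_1\\ x_2&\overline x_1&\xi_3\end{pmatrix}$, $\xi_i\in C$, $x_i\in\mathbb C^C$; $\det X=\xi_1\xi_2\xi_3+x_1x_2x_3+\overline{x_1x_2x_3}-\sum_i\xi_ix_i\overline x_i\in C$; $(X,Y)=\mathrm{tr}\big(\tfrac12(XY+YX)\big)\in C$. $\tau$ is the complex conjugation of $\mathfrak J(3,\mathbb C^C)$ with respect to $C$ (i.e. $i\mapsto-i$, fixing $\mathbf i$); $\sigma X=I_1XI_1$, $I_1=\mathrm{diag}(-1,1,1)$; $\langle X,Y\rangle_\sigma=(\tau\sigma X,Y)$. $\mathrm{Iso}_C(V)$ is the group of $C$-linear automorphisms of $V$. $SU(1,2)=\{A\in M(3,\mathbb C)\mid AI_1A^*=I_1,\ \det A=1\}$. *)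

theory Defs
  imports "HOL-Analysis.Analysis" "HOL-Algebra.Bij" "HOL-Algebra.Elementary_Groups"
begin

section \<open>The algebra obtained by complexifying the complex numbers\<close>

text \<open>
  Two copies of the complex numbers occur.  The first one has the bold imaginary unit, here
  called \<open>bi\<close>; the second one, used for complexification, is the type \<^typ>\<open>complex\<close> with unit
  \<^term>\<open>\<i>\<close>.  The tensor product of the two over the reals is the free module with basis
  \<open>1, bi\<close> over the second copy: \<open>Bicomplex a b\<close> stands for \<open>a + b bi\<close>.
\<close>

datatype bicomplex = Bicomplex (bre: complex) (bim: complex)

instantiation bicomplex :: comm_ring_1
begin

definition "0 = Bicomplex 0 0"
definition "1 = Bicomplex 1 0"
definition "- x = Bicomplex (- bre x) (- bim x)"
definition "x + y = Bicomplex (bre x + bre y) (bim x + bim y)"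
definition "x - y = Bicomplex (bre x - bre y) (bim x - bim y)"
definition "x * y = Bicomplex (bre x * bre y - bim x * bim y) (bre x * bim y + bim x * bre y)"

instance
  by standard
    (auto simp: zero_bicomplex_def one_bicomplex_def uminus_bicomplex_def plus_bicomplex_def
       minus_bicomplex_def times_bicomplex_def algebra_simps)

end

text \<open>The inclusion of the copy used for complexification (the scalars).\<close>

definition of_C :: "complex \<Rightarrow> bicomplex" where
  "of_C c = Bicomplex c 0"

text \<open>The conjugation \<open>bi \<mapsto> - bi\<close>, extended linearly over the scalars.\<close>

definition bconj :: "bicomplex \<Rightarrow> bicomplex" where
  "bconj x = Bicomplex (bre x) (- bim x)"

text \<open>The conjugation of the scalars, \<open>\<i> \<mapsto> - \<i>\<close>, fixing \<open>bi\<close>.\<close>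

definition btau :: "bicomplex \<Rightarrow> bicomplex" where
  "btau x = Bicomplex (cnj (bre x)) (cnj (bim x))"


section \<open>The Jordan algebra of Hermitian matrices\<close>

definition hscale :: "complex \<Rightarrow> bicomplex^3^3 \<Rightarrow> bicomplex^3^3" where
  "hscale c = map_matrix (\<lambda>x. of_C c * x)"

definition J3 :: "(bicomplex^3^3) set" where
  "J3 = {X. transpose (map_matrix bconj X) = X}"

text \<open>
  For \<open>X \<in> J3\<close> the coordinates are \<open>\<xi>\<^sub>k = X $ k $ k\<close> and \<open>x\<^sub>1 = X $ 2 $ 3\<close>,
  \<open>x\<^sub>2 = X $ 3 $ 1\<close>, \<open>x\<^sub>3 = X $ 1 $ 2\<close>.  The values of \<open>Jdet\<close> and \<open>Jinner\<close> on \<open>J3\<close> are scalars,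
  see \<open>Jdet_scalar\<close> and \<open>Jinner_scalar\<close> below.
\<close>

definition Jdet :: "bicomplex^3^3 \<Rightarrow> bicomplex" where
  "Jdet X =
    (let \<xi>1 = X $ 1 $ 1; \<xi>2 = X $ 2 $ 2; \<xi>3 = X $ 3 $ 3;
         x1 = X $ 2 $ 3; x2 = X $ 3 $ 1; x3 = X $ 1 $ 2
     in \<xi>1 * \<xi>2 * \<xi>3 + x1 * x2 * x3 + bconj (x1 * x2 * x3)
        - (\<xi>1 * x1 * bconj x1 + \<xi>2 * x2 * bconj x2 + \<xi>3 * x3 * bconj x3))"

definition Jinner :: "bicomplex^3^3 \<Rightarrow> bicomplex^3^3 \<Rightarrow> bicomplex" where
  "Jinner X Y = trace (hscale (1/2) (X ** Y + Y ** X))"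

definition I1 :: "'a::ring_1^3^3" where
  "I1 = (\<chi> i j. if i = j then (if i = 1 then - 1 else 1) else 0)"

definition Jtau :: "bicomplex^3^3 \<Rightarrow> bicomplex^3^3" where
  "Jtau = map_matrix btau"

definition Jsigma :: "bicomplex^3^3 \<Rightarrow> bicomplex^3^3" where
  "Jsigma X = I1 ** X ** I1"

definition Jherm :: "bicomplex^3^3 \<Rightarrow> bicomplex^3^3 \<Rightarrow> bicomplex" where
  "Jherm X Y = Jinner (Jtau (Jsigma X)) Y"


section \<open>The groups\<close>

text \<open>Maps on \<open>J3\<close> are represented by functions that are \<open>undefined\<close> outside \<open>J3\<close>, as in \<^const>\<open>Bij\<close>.\<close>

definition IsoC_J3 :: "(bicomplex^3^3 \<Rightarrow> bicomplex^3^3) set" where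
  "IsoC_J3 = {\<alpha> \<in> Bij J3.
     (\<forall>X\<in>J3. \<forall>Y\<in>J3. \<alpha> (X + Y) = \<alpha> X + \<alpha> Y) \<and>
     (\<forall>c. \<forall>X\<in>J3. \<alpha> (hscale c X) = hscale c (\<alpha> X))}"

definition E6_m14_C :: "(bicomplex^3^3 \<Rightarrow> bicomplex^3^3) monoid" where
  "E6_m14_C = (BijGroup J3)\<lparr>carrier :=
     {\<alpha> \<in> IsoC_J3.
        (\<forall>X\<in>J3. Jdet (\<alpha> X) = Jdet X) \<and>
        (\<forall>X\<in>J3. \<forall>Y\<in>J3. Jherm (\<alpha> X) (\<alpha> Y) = Jherm X Y)}\<rparr>"

text \<open>Here the entries belong to the first copy of the complex numbers, with imaginary unit \<open>bi\<close>.\<close>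

definition SU12 :: "(complex^3^3) monoid" where
  "SU12 = \<lparr>carrier = {A. A ** I1 ** transpose (map_matrix cnj A) = I1 \<and> det A = 1},
           mult = (**), one = mat 1\<rparr>"

text \<open>\<^term>\<open>mat w\<close> is the scalar matrix \<open>w E\<close>.\<close>

definition Z3 :: "complex \<Rightarrow> ((complex^3^3) \<times> (complex^3^3)) set" where
  "Z3 w = {(mat 1, mat 1), (mat w, mat w), (mat (w^2), mat (w^2))}"

definition SU12_quot :: "complex \<Rightarrow> ((complex^3^3) \<times> (complex^3^3)) set monoid" where
  "SU12_quot w = (SU12 \<times>\<times> SU12) Mod Z3 w"

definition eps :: "(complex^3^3) \<times> (complex^3^3) \<Rightarrow> (complex^3^3) \<times> (complex^3^3)" where
  "eps = (\<lambda>(A, B). (map_matrix cnj B, map_matrix cnj A))"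

text \<open>
  The group of order two is represented by \<^term>\<open>integer_mod_group 2\<close> with carrier
  \<open>{0, 1}\<close>; its nontrivial element acts on a coset by taking the image under \<open>eps\<close>.
\<close>

definition eps_action ::
    "complex \<Rightarrow> int \<Rightarrow> ((complex^3^3) \<times> (complex^3^3)) set \<Rightarrow> ((complex^3^3) \<times> (complex^3^3)) set" where
  "eps_action w k = (\<lambda>S \<in> carrier (SU12_quot w). (eps ^^ nat k) ` S)"

text \<open>The semidirect product for an action \<open>\<phi>\<close>, a homomorphism from \<open>H\<close> to \<^term>\<open>AutoGroup N\<close>.\<close>

definition semidirect_product ::
    "('n, 'x) monoid_scheme \<Rightarrow> ('h, 'y) monoid_scheme \<Rightarrow> ('h \<Rightarrow> 'n \<Rightarrow> 'n) \<Rightarrow> ('n \<times> 'h) monoid" where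
  "semidirect_product N H \<phi> =
     \<lparr>carrier = carrier N \<times> carrier H,
      mult = (\<lambda>(n, h) (n', h'). (n \<otimes>\<^bsub>N\<^esub> \<phi> h n', h \<otimes>\<^bsub>H\<^esub> h')),
      one = (\<one>\<^bsub>N\<^esub>, \<one>\<^bsub>H\<^esub>)\<rparr>"


section \<open>Well-definedness\<close>

lemma J3_iff: "X \<in> J3 \<longleftrightarrow> (\<forall>i j. bconj (X $ j $ i) = X $ i $ j)"
  by (simp add: J3_def vec_eq_iff transpose_def)

lemmas bicomplex_ops = zero_bicomplex_def one_bicomplex_def uminus_bicomplex_def
  plus_bicomplex_def minus_bicomplex_def times_bicomplex_def of_C_def bconj_def btau_def

lemma bconj_simps [simp]:
  "bconj 0 = 0" "bconj 1 = 1" "bconj 2 = 2" "bconj (of_C c) = of_C c" "bconj (bconj x) = x"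
  "bconj (- x) = - bconj x" "bconj (x + y) = bconj x + bconj y"
  "bconj (x - y) = bconj x - bconj y" "bconj (x * y) = bconj x * bconj y"
  "bconj (btau x) = btau (bconj x)"
  by (simp_all add: bicomplex_ops flip: one_add_one[where 'a = bicomplex])

lemma scalar_iff: "x \<in> range of_C \<longleftrightarrow> bconj x = x"
proof
  assume "bconj x = x"
  then have "x = of_C (bre x)"
    by (cases x) (simp add: bconj_def of_C_def)
  then show "x \<in> range of_C" by blast
qed auto

lemma Jdet_scalar: "X \<in> J3 \<Longrightarrow> Jdet X \<in> range of_C"
  by (simp add: scalar_iff Jdet_def Let_def J3_iff algebra_simps)

lemma Jsigma_J3: "X \<in> J3 \<Longrightarrow> Jsigma X \<in> J3"
  by (simp add: J3_iff Jsigma_def I1_def matrix_matrix_mult_def forall_3 sum_3)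

lemma Jtau_J3: "X \<in> J3 \<Longrightarrow> Jtau X \<in> J3"
  by (simp add: J3_iff Jtau_def)

lemma Jinner_scalar: "X \<in> J3 \<Longrightarrow> Y \<in> J3 \<Longrightarrow> Jinner X Y \<in> range of_C"
  by (simp add: scalar_iff J3_iff Jinner_def hscale_def trace_def sum_3 matrix_matrix_mult_def
      algebra_simps)

lemma J3_add: "X \<in> J3 \<Longrightarrow> Y \<in> J3 \<Longrightarrow> X + Y \<in> J3"
  by (simp add: J3_iff)

lemma J3_hscale: "X \<in> J3 \<Longrightarrow> hscale c X \<in> J3"
  by (simp add: J3_iff hscale_def)

lemma E6_m14_C_subgroup: "subgroup (carrier E6_m14_C) (BijGroup J3)"
proof -
  have mem: "\<alpha> \<in> carrier E6_m14_C \<longleftrightarrow> \<alpha> \<in> Bij J3 \<and>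
      (\<forall>X\<in>J3. \<forall>Y\<in>J3. \<alpha> (X + Y) = \<alpha> X + \<alpha> Y) \<and>
      (\<forall>c. \<forall>X\<in>J3. \<alpha> (hscale c X) = hscale c (\<alpha> X)) \<and>
      (\<forall>X\<in>J3. Jdet (\<alpha> X) = Jdet X) \<and>
      (\<forall>X\<in>J3. \<forall>Y\<in>J3. Jherm (\<alpha> X) (\<alpha> Y) = Jherm X Y)" for \<alpha>
    by (auto simp: E6_m14_C_def IsoC_J3_def)
  have B: "\<alpha> X \<in> J3" if "\<alpha> \<in> Bij J3" "X \<in> J3" for \<alpha> X
    using that Bij_imp_funcset by blast
  show ?thesis
  proof (rule group.subgroupI[OF group_BijGroup])
    show "carrier E6_m14_C \<subseteq> carrier (BijGroup J3)"
      by (auto simp: mem BijGroup_def)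
    have "(\<lambda>X\<in>J3. X) \<in> carrier E6_m14_C"
      unfolding mem
      by (intro conjI allI ballI) (simp_all only: id_Bij J3_add J3_hscale restrict_apply if_True)
    then show "carrier E6_m14_C \<noteq> {}" by blast
  next
    fix \<alpha> \<beta> assume ab: "\<alpha> \<in> carrier E6_m14_C" "\<beta> \<in> carrier E6_m14_C"
    then show "\<alpha> \<otimes>\<^bsub>BijGroup J3\<^esub> \<beta> \<in> carrier E6_m14_C"
      by (simp add: mem BijGroup_def compose_Bij compose_eq B J3_add J3_hscale)
  next
    fix \<alpha> assume a: "\<alpha> \<in> carrier E6_m14_C"
    define \<beta> where "\<beta> = (\<lambda>x \<in> J3. inv_into J3 \<alpha> x)"
    have aB: "\<alpha> \<in> Bij J3" using a mem by blast
    have bB: "\<beta> \<in> Bij J3" unfolding \<beta>_def using aB by (rule restrict_inv_into_Bij)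
    have ab: "\<alpha> (\<beta> X) = X" if "X \<in> J3" for X
      using that aB by (auto simp: \<beta>_def Bij_def bij_betw_def f_inv_into_f)
    have ba: "\<beta> (\<alpha> X) = X" if "X \<in> J3" for X
      using that aB B[OF aB that] by (auto simp: \<beta>_def Bij_def bij_betw_def)
    have "\<beta> (X + Y) = \<beta> X + \<beta> Y" if "X \<in> J3" "Y \<in> J3" for X Y
      using a ba[of "\<beta> X + \<beta> Y"] that by (simp add: mem ab B[OF bB] J3_add)
    moreover have "\<beta> (hscale c X) = hscale c (\<beta> X)" if "X \<in> J3" for X c
      using a ba[of "hscale c (\<beta> X)"] that by (simp add: mem ab B[OF bB] J3_hscale)
    moreover have "Jdet (\<beta> X) = Jdet X" if "X \<in> J3" for X
      using a that ab B[OF bB] by (metis mem)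
    moreover have "Jherm (\<beta> X) (\<beta> Y) = Jherm X Y" if "X \<in> J3" "Y \<in> J3" for X Y
      using a that ab B[OF bB] by (metis mem)
    ultimately show "inv\<^bsub>BijGroup J3\<^esub> \<alpha> \<in> carrier E6_m14_C"
      using bB by (simp add: inv_BijGroup[OF aB] mem flip: \<beta>_def)
  qed
qed

lemma group_E6_m14_C: "group E6_m14_C"
  using group.subgroup_imp_group[OF group_BijGroup E6_m14_C_subgroup]
  by (simp add: E6_m14_C_def)

lemma I1_I1: "(I1 :: complex^3^3) ** I1 = mat 1"
  by (simp add: I1_def matrix_matrix_mult_def vec_eq_iff forall_3 sum_3 mat_def)

lemma cnj_matrix_mult: "map_matrix cnj (A ** B) = map_matrix cnj A ** map_matrix cnj (B :: complex^3^3)"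
  by (simp add: matrix_matrix_mult_def vec_eq_iff)

lemma cnj_matrix_I1: "map_matrix cnj I1 = I1"
  by (simp add: I1_def vec_eq_iff)

lemma cnj_matrix_cnj_matrix: "map_matrix cnj (map_matrix cnj A) = A"
  by (simp add: vec_eq_iff)

lemma transpose_I1: "transpose I1 = (I1 :: complex^3^3)"
  by (auto simp: I1_def transpose_def vec_eq_iff)

lemma cnj_matrix_transpose: "map_matrix cnj (transpose A) = transpose (map_matrix cnj A)"
  by (simp add: transpose_def vec_eq_iff)

lemma group_SU12: "group SU12"
proof (rule groupI)
  fix A B assume "A \<in> carrier SU12" "B \<in> carrier SU12"
  then have A: "A ** I1 ** transpose (map_matrix cnj A) = I1" "det A = 1"
    and B: "B ** I1 ** transpose (map_matrix cnj B) = I1" "det B = 1"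
    by (auto simp: SU12_def)
  have "(A ** B) ** I1 ** transpose (map_matrix cnj (A ** B))
      = A ** (B ** I1 ** transpose (map_matrix cnj B)) ** transpose (map_matrix cnj A)"
    by (simp add: cnj_matrix_mult matrix_transpose_mul matrix_mul_assoc)
  then show "A \<otimes>\<^bsub>SU12\<^esub> B \<in> carrier SU12"
    using A B by (simp add: SU12_def det_mul)
next
  have "map_matrix cnj (mat 1 :: complex^3^3) = mat 1"
    by (simp add: mat_def vec_eq_iff)
  then show "\<one>\<^bsub>SU12\<^esub> \<in> carrier SU12"
    by (simp add: SU12_def transpose_mat)
next
  fix A assume "A \<in> carrier SU12"
  then have A: "A ** I1 ** transpose (map_matrix cnj A) = I1" "det A = 1"
    by (auto simp: SU12_def)
  define B where "B = I1 ** transpose (map_matrix cnj A) ** I1"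
  have "A ** B = I1 ** I1"
    unfolding B_def using A(1) by (simp add: matrix_mul_assoc)
  then have "A ** B = mat 1" by (simp add: I1_I1)
  then have BA: "B ** A = mat 1" by (simp add: matrix_left_right_inverse)
  have "transpose (map_matrix cnj B) = I1 ** A ** I1"
    unfolding B_def
    by (simp add: cnj_matrix_mult matrix_transpose_mul cnj_matrix_I1 transpose_I1
        cnj_matrix_transpose cnj_matrix_cnj_matrix matrix_mul_assoc)
  then have "B ** I1 ** transpose (map_matrix cnj B) = B ** (I1 ** I1) ** A ** I1"
    by (simp add: matrix_mul_assoc)
  then have 1: "B ** I1 ** transpose (map_matrix cnj B) = I1"
    by (simp add: I1_I1 BA)
  have "det B * det A = 1" using BA by (metis det_mul det_I)
  then have "det B = 1" using A by simp
  with 1 have "B \<in> carrier SU12" by (simp add: SU12_def)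
  with BA show "\<exists>B\<in>carrier SU12. B \<otimes>\<^bsub>SU12\<^esub> A = \<one>\<^bsub>SU12\<^esub>"
    by (auto simp: SU12_def)
qed (auto simp: SU12_def matrix_mul_assoc)

lemma mat_SU12:
  assumes "w ^ 3 = 1"
  shows "mat w \<in> carrier SU12"
proof -
  have "norm w = 1" using assms by (metis power_eq_1_iff zero_neq_numeral)
  then have "w * cnj w = 1" by (simp add: complex_norm_square[symmetric])
  then have "mat w ** I1 ** transpose (map_matrix cnj (mat w)) = (I1 :: complex^3^3)"
    by (simp add: I1_def mat_def matrix_matrix_mult_def vec_eq_iff forall_3 sum_3 transpose_def)
  moreover have "det (mat w :: complex^3^3) = 1"
    using assms by (simp add: det_3 mat_def power3_eq_cube)
  ultimately show ?thesis by (simp add: SU12_def)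
qed

lemma mat_mult_mat: "mat a ** mat b = (mat (a * b) :: complex^3^3)"
  by (simp add: mat_def matrix_matrix_mult_def vec_eq_iff forall_3 sum_3)

lemma mat_commute: "mat w ** A = A ** (mat w :: complex^3^3)" for A :: "complex^3^3"
  by (simp add: mat_def matrix_matrix_mult_def vec_eq_iff forall_3 sum_3)

lemma Z3_normal:
  assumes w: "w ^ 3 = 1"
  shows "Z3 w \<lhd> (SU12 \<times>\<times> SU12)"
proof -
  interpret group "SU12 \<times>\<times> SU12"
    by (intro DirProd_group group_SU12)
  have sq: "(w\<^sup>2) ^ 3 = 1" using w by (metis mult.commute power_mult power_one)
  have ww: "w * w\<^sup>2 = 1" "w\<^sup>2 * w = 1" "w\<^sup>2 * w\<^sup>2 = w"
    using w by (simp_all add: power2_eq_square power3_eq_cube mult.assoc)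
  have "w ^ 4 = w ^ 3 * w" by (simp add: power4_eq_xxxx power3_eq_cube)
  then have w4: "w ^ 4 = w" using w by simp
  have sub: "Z3 w \<subseteq> carrier (SU12 \<times>\<times> SU12)"
    using mat_SU12[OF w] mat_SU12[OF sq] group.is_monoid[OF group_SU12]
      mat_SU12[of 1] by (auto simp: Z3_def)
  have mult: "x \<otimes>\<^bsub>SU12 \<times>\<times> SU12\<^esub> y \<in> Z3 w" if "x \<in> Z3 w" "y \<in> Z3 w" for x y
    using that by (auto simp: Z3_def SU12_def DirProd_def mat_mult_mat ww w4 power2_eq_square[symmetric])
  have "subgroup (Z3 w) (SU12 \<times>\<times> SU12)"
  proof (rule subgroupI)
    fix x assume x: "x \<in> Z3 w"
    then have "\<exists>y\<in>Z3 w. y \<otimes>\<^bsub>SU12 \<times>\<times> SU12\<^esub> x = \<one>\<^bsub>SU12 \<times>\<times> SU12\<^esub>"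
      by (auto simp: Z3_def SU12_def DirProd_def mat_mult_mat ww)
    then obtain y where "y \<in> Z3 w" "y \<otimes>\<^bsub>SU12 \<times>\<times> SU12\<^esub> x = \<one>\<^bsub>SU12 \<times>\<times> SU12\<^esub>" ..
    then show "inv\<^bsub>SU12 \<times>\<times> SU12\<^esub> x \<in> Z3 w"
      using x sub inv_equality[of y x] by auto
  qed (use sub mult in \<open>auto simp: Z3_def\<close>)
  then show ?thesis
  proof (rule normalI[rule_format])
    fix x assume "x \<in> carrier (SU12 \<times>\<times> SU12)"
    show "Z3 w #>\<^bsub>SU12 \<times>\<times> SU12\<^esub> x = x <#\<^bsub>SU12 \<times>\<times> SU12\<^esub> Z3 w"
      by (cases x) (simp add: r_coset_def l_coset_def Z3_def SU12_def DirProd_def mat_commute)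
  qed
qed

lemma group_semidirect_product:
  assumes N: "group N" and H: "group H" and hom: "\<phi> \<in> hom H (AutoGroup N)"
  shows "group (semidirect_product N H \<phi>)"
proof -
  interpret N: group N by fact
  interpret H: group H by fact
  have au: "\<phi> h \<in> auto N" if "h \<in> carrier H" for h
    using hom that by (auto simp: hom_def AutoGroup_def)
  have cl: "\<phi> h n \<in> carrier N" if "h \<in> carrier H" "n \<in> carrier N" for h n
    using au[OF that(1)] that(2) by (auto simp: auto_def hom_def)
  have mu: "\<phi> h (n \<otimes>\<^bsub>N\<^esub> m) = \<phi> h n \<otimes>\<^bsub>N\<^esub> \<phi> h m"
    if "h \<in> carrier H" "n \<in> carrier N" "m \<in> carrier N" for h n m
    using au[OF that(1)] that by (auto simp: auto_def hom_def)
  have co: "\<phi> (h \<otimes>\<^bsub>H\<^esub> k) n = \<phi> h (\<phi> k n)"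
    if "h \<in> carrier H" "k \<in> carrier H" "n \<in> carrier N" for h k n
    using hom au[OF that(1)] au[OF that(2)] that
    by (auto simp: hom_def AutoGroup_def BijGroup_def auto_def compose_def)
  have one: "\<phi> \<one>\<^bsub>H\<^esub> n = n" if "n \<in> carrier N" for n
  proof -
    have "inj_on (\<phi> \<one>\<^bsub>H\<^esub>) (carrier N)"
      using au[of "\<one>\<^bsub>H\<^esub>"] by (auto simp: auto_def Bij_def bij_betw_def)
    moreover have "\<phi> \<one>\<^bsub>H\<^esub> (\<phi> \<one>\<^bsub>H\<^esub> n) = \<phi> \<one>\<^bsub>H\<^esub> n"
      using co[of "\<one>\<^bsub>H\<^esub>" "\<one>\<^bsub>H\<^esub>" n] that by simp
    ultimately show ?thesis using that cl[of "\<one>\<^bsub>H\<^esub>" n] by (auto dest: inj_onD)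
  qed
  show ?thesis
  proof (rule groupI, goal_cases)
    case (5 x)
    then obtain n h where x: "x = (n, h)" "n \<in> carrier N" "h \<in> carrier H"
      by (auto simp: semidirect_product_def)
    let ?k = "inv\<^bsub>H\<^esub> h"
    have k: "?k \<in> carrier H" using x by simp
    have "inv\<^bsub>N\<^esub> (\<phi> ?k n) \<otimes>\<^bsub>N\<^esub> \<phi> ?k n = \<one>\<^bsub>N\<^esub>"
      using cl[OF k x(2)] by simp
    then show ?case
      using x k cl[OF k x(2)]
      by (intro bexI[of _ "(inv\<^bsub>N\<^esub> (\<phi> ?k n), ?k)"]) (auto simp: semidirect_product_def)
  qed (auto simp: semidirect_product_def cl mu co one N.m_assoc H.m_assoc)
qed

lemma eps_eps: "eps (eps x) = x"
  by (cases x) (simp add: eps_def cnj_matrix_cnj_matrix)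

lemma eps_hom: "eps \<in> hom (SU12 \<times>\<times> SU12) (SU12 \<times>\<times> SU12)"
proof -
  have "map_matrix cnj A \<in> carrier SU12" if "A \<in> carrier SU12" for A
  proof -
    from that have A: "A ** I1 ** transpose (map_matrix cnj A) = I1" "det A = 1"
      by (auto simp: SU12_def)
    have "map_matrix cnj (A ** I1 ** transpose (map_matrix cnj A)) = map_matrix cnj I1"
      using A(1) by simp
    then have "map_matrix cnj A ** I1 ** transpose (map_matrix cnj (map_matrix cnj A)) = I1"
      by (simp only: cnj_matrix_mult cnj_matrix_I1 cnj_matrix_transpose)
    moreover have "det (map_matrix cnj A) = cnj (det A)"
      by (simp add: det_3)
    ultimately show ?thesis
      using A(2) by (simp add: SU12_def)
  qed
  note cl = this
  show ?thesis
  proof (rule homI)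
    fix x assume "x \<in> carrier (SU12 \<times>\<times> SU12)"
    then show "eps x \<in> carrier (SU12 \<times>\<times> SU12)"
      using cl by (cases x) (simp add: eps_def)
  next
    fix x y :: "(complex^3^3) \<times> (complex^3^3)"
    have "A \<otimes>\<^bsub>SU12\<^esub> B = A ** B" for A B by (simp add: SU12_def)
    then show "eps (x \<otimes>\<^bsub>SU12 \<times>\<times> SU12\<^esub> y) = eps x \<otimes>\<^bsub>SU12 \<times>\<times> SU12\<^esub> eps y"
      by (cases x, cases y) (simp add: eps_def cnj_matrix_mult)
  qed
qed

lemma eps_Z3:
  assumes "w ^ 3 = 1"
  shows "eps ` Z3 w = Z3 w"
proof -
  have "norm w = 1" using assms by (metis power_eq_1_iff zero_neq_numeral)
  then have "w * cnj w = 1" by (simp add: complex_norm_square[symmetric])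
  moreover have "w * w\<^sup>2 = 1" using assms by (simp add: power2_eq_square power3_eq_cube mult.assoc)
  moreover have "w \<noteq> 0" using assms by auto
  ultimately have c: "cnj w = w\<^sup>2" by (metis mult_left_cancel)
  then have c2: "(cnj w)\<^sup>2 = w" by (metis complex_cnj_cnj complex_cnj_power)
  have m: "map_matrix cnj (mat a) = mat (cnj a)" for a :: complex
    by (simp add: mat_def vec_eq_iff)
  show ?thesis using c2
    by (simp add: Z3_def eps_def m insert_commute flip: c)
qed

lemma eps_action_hom:
  assumes w: "w ^ 3 = 1"
  shows "eps_action w \<in> hom (integer_mod_group 2) (AutoGroup (SU12_quot w))"
proof -
  interpret Z: normal "Z3 w" "SU12 \<times>\<times> SU12" using w by (rule Z3_normal)
  let ?G = "SU12 \<times>\<times> SU12" and ?Q = "SU12_quot w"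
  have Q: "group ?Q" unfolding SU12_quot_def by (rule Z.factorgroup_is_group)
  have ee: "eps ` eps ` S = S" for S by (simp add: image_image eps_eps)
  have sm: "eps ` (S <#>\<^bsub>?G\<^esub> T) = eps ` S <#>\<^bsub>?G\<^esub> eps ` T"
    if "S \<subseteq> carrier ?G" "T \<subseteq> carrier ?G" for S T
  proof -
    have "eps (x \<otimes>\<^bsub>?G\<^esub> y) = eps x \<otimes>\<^bsub>?G\<^esub> eps y" if "x \<in> S" "y \<in> T" for x y
      using that \<open>S \<subseteq> _\<close> \<open>T \<subseteq> _\<close> by (intro hom_mult[OF eps_hom]) (blast intro: subsetD)+
    then have "(\<Union>x\<in>S. \<Union>y\<in>T. {eps (x \<otimes>\<^bsub>?G\<^esub> y)}) = (\<Union>x\<in>S. \<Union>y\<in>T. {eps x \<otimes>\<^bsub>?G\<^esub> eps y})"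
      by (intro SUP_cong refl) (simp only:)
    then show ?thesis
      by (simp only: set_mult_def image_UN image_insert image_empty UN_simps(10))
  qed
  have sub: "S \<subseteq> carrier ?G" if "S \<in> carrier ?Q" for S
    using that Z.rcosets_carrier[OF Z.is_group] by (simp add: SU12_quot_def FactGroup_def)
  have cl: "eps ` S \<in> carrier ?Q" if S: "S \<in> carrier ?Q" for S
  proof -
    from S obtain x where x: "x \<in> carrier ?G" "S = Z3 w #>\<^bsub>?G\<^esub> x"
      by (auto simp: SU12_quot_def FactGroup_def RCOSETS_def simp del: carrier_DirProd)
    then have "S = Z3 w <#>\<^bsub>?G\<^esub> {x}" by (simp add: r_coset_eq_set_mult)
    then have "eps ` S = Z3 w <#>\<^bsub>?G\<^esub> {eps x}"
      using sm[OF Z.subset, of "{x}"] x eps_Z3[OF w] by simp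
    moreover have "eps x \<in> carrier ?G" using eps_hom x by (auto simp: hom_def simp del: carrier_DirProd)
    ultimately show ?thesis
      by (auto simp: SU12_quot_def FactGroup_def RCOSETS_def r_coset_eq_set_mult simp del: carrier_DirProd)
  qed
  have 0: "eps_action w 0 = (\<lambda>S\<in>carrier ?Q. S)"
    by (auto simp: eps_action_def)
  have 1: "eps_action w 1 = (\<lambda>S\<in>carrier ?Q. eps ` S)"
    by (auto simp: eps_action_def)
  have a0: "eps_action w 0 \<in> auto ?Q"
    unfolding 0 by (rule group.id_in_auto[OF Q])
  have "bij_betw (\<lambda>S\<in>carrier ?Q. eps ` S) (carrier ?Q) (carrier ?Q)"
    by (rule bij_betw_byWitness[where f' = "\<lambda>S. eps ` S"]) (auto simp: cl ee)
  moreover have "S \<otimes>\<^bsub>?Q\<^esub> T \<in> carrier ?Q" if "S \<in> carrier ?Q" "T \<in> carrier ?Q" for S T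
    using that Q by (simp add: group.is_monoid monoid.m_closed)
  moreover have "eps ` (S \<otimes>\<^bsub>?Q\<^esub> T) = eps ` S \<otimes>\<^bsub>?Q\<^esub> eps ` T"
    if "S \<in> carrier ?Q" "T \<in> carrier ?Q" for S T
    using sm[OF sub[OF that(1)] sub[OF that(2)]] by (simp add: SU12_quot_def FactGroup_def)
  ultimately have a1: "eps_action w 1 \<in> auto ?Q"
    unfolding 1 auto_def Bij_def hom_def by (auto simp: cl)
  have k: "k = 0 \<or> k = 1" if "k \<in> carrier (integer_mod_group 2)" for k
    using that by (auto simp: carrier_integer_mod_group)
  have c11: "compose (carrier ?Q) (eps_action w 1) (eps_action w 1) = eps_action w 0"
    unfolding 0 1 compose_def by (rule ext) (auto simp: cl ee)
  have co: "compose (carrier ?Q) (eps_action w 0) (eps_action w k) = eps_action w k"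
    "compose (carrier ?Q) (eps_action w k) (eps_action w 0) = eps_action w k"
    if "k = 0 \<or> k = 1" for k
  proof -
    have "eps_action w k \<in> extensional (carrier ?Q)" "eps_action w k \<in> carrier ?Q \<rightarrow> carrier ?Q"
      using a0 a1 that by (auto simp: auto_def Bij_def dest: bij_betw_imp_funcset)
    then show "compose (carrier ?Q) (eps_action w 0) (eps_action w k) = eps_action w k"
      "compose (carrier ?Q) (eps_action w k) (eps_action w 0) = eps_action w k"
      unfolding 0 by (auto intro: Id_compose compose_Id)
  qed
  show ?thesis
    using a0 a1 c11 co
    by (auto simp: hom_def AutoGroup_def BijGroup_def auto_def dest!: k)
qed

end

theory Submission
  imports Defs
begin

text \<open>
  Sending the bold imaginary unit to \<open>\<i>\<close> identifies the Hermitian matrices with all complex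
  \<open>3 \<times> 3\<close> matrices \<open>P\<close>; the cubic form becomes \<open>det P\<close> and the Hermitian form becomes
  \<open>tr (I1 P\<^sup>* I1 Q)\<close>.  A linear bijection preserving \<open>det\<close> preserves the matrices of rank at most
  one, hence (Frobenius) has the form \<open>P \<mapsto> U P V\<close> or \<open>P \<mapsto> U P\<^sup>t V\<close>, and preservation of the
  Hermitian form lets one choose \<open>U = A\<close>, \<open>V = B\<^sup>*\<close> with \<open>A\<close> and \<open>B\<close> in \<open>SU(1,2)\<close>.  The pairs
  \<open>(A, B)\<close> acting trivially form \<open>\<int>\<^sub>3\<close>, and conjugation by transposition, which is not of the
  first form, sends \<open>(A, B)\<close> to \<open>(cnj B, cnj A)\<close>.
\<close>

section \<open>Linear preservers of the determinant\<close>


text \<open>All 2 x 2 minors vanish; this polynomial form of the rank condition can be detected by a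
  quadratic identity between determinants.\<close>

definition rank_le_one :: "complex^3^3 \<Rightarrow> bool" where
  "rank_le_one P \<longleftrightarrow> (\<forall>i j k l. P $ i $ j * P $ k $ l = P $ i $ l * P $ k $ j)"

definition unit_matrix :: "3 \<Rightarrow> 3 \<Rightarrow> complex^3^3" where
  "unit_matrix i j = (\<chi> k l. if k = i \<and> l = j then 1 else 0)"

definition linear_map :: "(complex^3^3 \<Rightarrow> complex^3^3) \<Rightarrow> bool" where
  "linear_map g \<longleftrightarrow> (\<forall>P Q. g (P + Q) = g P + g Q) \<and> (\<forall>c P. g (mat c ** P) = mat c ** g P)"

definition det_preserver :: "(complex^3^3 \<Rightarrow> complex^3^3) \<Rightarrow> bool" where
  "det_preserver g \<longleftrightarrow> linear_map g \<and> bij g \<and> (\<forall>P. det (g P) = det P)"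

lemma unit_matrix_nth [simp]: "unit_matrix i j $ k $ l = (if k = i \<and> l = j then 1 else 0)"
  by (simp add: unit_matrix_def)

lemma mat_mult_nth [simp]: "(mat c ** (P :: complex^3^3)) $ i $ j = c * P $ i $ j"
  using exhaust_3[of i] by (auto simp: matrix_matrix_mult_def mat_def sum_3)

lemma matrix_mult_3_nth: "((A :: complex^3^3) ** B) $ i $ j = (\<Sum>k\<in>UNIV. A $ i $ k * B $ k $ j)"
  by (simp add: matrix_matrix_mult_def)

lemma linear_map_add: "linear_map g \<Longrightarrow> g (P + Q) = g P + g Q"
  by (simp add: linear_map_def)

lemma linear_map_scale: "linear_map g \<Longrightarrow> g (mat c ** P) = mat c ** g P"
  by (simp add: linear_map_def)

lemma linear_map_zero: "linear_map g \<Longrightarrow> g 0 = 0"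
  using linear_map_add[of g 0 0] by simp

lemma linear_map_sum: "linear_map g \<Longrightarrow> g (\<Sum>i\<in>S. f i) = (\<Sum>i\<in>S. g (f i))"
  by (induction S rule: infinite_finite_induct) (simp_all add: linear_map_zero linear_map_add)

lemma unit_matrix_expansion:
  "P = (\<Sum>i\<in>UNIV. \<Sum>j\<in>UNIV. mat (P $ i $ j) ** unit_matrix i j)"
  by (simp add: vec_eq_iff forall_3 sum_3)

lemma linear_map_nth:
  assumes "linear_map g"
  shows "g P $ a $ b = (\<Sum>i\<in>UNIV. \<Sum>j\<in>UNIV. P $ i $ j * g (unit_matrix i j) $ a $ b)"
proof -
  have "g P = g (\<Sum>i\<in>UNIV. \<Sum>j\<in>UNIV. mat (P $ i $ j) ** unit_matrix i j)"
    by (simp flip: unit_matrix_expansion)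
  also have "\<dots> = (\<Sum>i\<in>UNIV. \<Sum>j\<in>UNIV. mat (P $ i $ j) ** g (unit_matrix i j))"
    by (simp add: linear_map_sum linear_map_scale assms)
  finally show ?thesis by simp
qed

text \<open>
  \<open>det (Q + P) + det (Q - P) - 2 det Q\<close> is twice the trace of the product of \<open>Q\<close> and the adjugate of \<open>P\<close>.
\<close>

lemma rank_le_one_iff_det:
  "rank_le_one P \<longleftrightarrow> (\<forall>Q. det (Q + P) + det (Q - P) = 2 * det Q)"
proof
  assume "rank_le_one P"
  then have r: "P $ i $ j * P $ k $ l = P $ i $ l * P $ k $ j" for i j k l
    by (simp add: rank_le_one_def)
  have *: "det (Q + P) + det (Q - P) - 2 * det Q =
    2 * (Q$1$1 * (P$2$2 * P$3$3 - P$2$3 * P$3$2) - Q$1$2 * (P$2$1 * P$3$3 - P$2$3 * P$3$1)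
     + Q$1$3 * (P$2$1 * P$3$2 - P$2$2 * P$3$1) - Q$2$1 * (P$1$2 * P$3$3 - P$1$3 * P$3$2)
     + Q$2$2 * (P$1$1 * P$3$3 - P$1$3 * P$3$1) - Q$2$3 * (P$1$1 * P$3$2 - P$1$2 * P$3$1)
     + Q$3$1 * (P$1$2 * P$2$3 - P$1$3 * P$2$2) - Q$3$2 * (P$1$1 * P$2$3 - P$1$3 * P$2$1)
     + Q$3$3 * (P$1$1 * P$2$2 - P$1$2 * P$2$1))" for Q
    unfolding det_3 by (simp add: algebra_simps)
  show "\<forall>Q. det (Q + P) + det (Q - P) = 2 * det Q"
  proof
    fix Q
    have "det (Q + P) + det (Q - P) - 2 * det Q = 0"
      unfolding * using r[of 2 2 3 3] r[of 2 1 3 3] r[of 2 1 3 2] r[of 1 2 3 3] r[of 1 1 3 3]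
        r[of 1 1 3 2] r[of 1 2 2 3] r[of 1 1 2 3] r[of 1 1 2 2] by simp
    then show "det (Q + P) + det (Q - P) = 2 * det Q" by simp
  qed
next
  assume d: "\<forall>Q. det (Q + P) + det (Q - P) = 2 * det Q"
  \<comment> \<open>With Q a unit matrix, everything but twice one cofactor of P cancels, so the
    nine choices yield the nine minors.\<close>
  have e: "det (unit_matrix i j + P) + det (unit_matrix i j - P) = 2 * det (unit_matrix i j)" for i j
    using d by blast
  show "rank_le_one P"
    using e[of 1 1] e[of 1 2] e[of 1 3] e[of 2 1] e[of 2 2] e[of 2 3] e[of 3 1] e[of 3 2] e[of 3 3]
    unfolding det_3 rank_le_one_def forall_3
    by (simp add: algebra_simps)
qed

lemma linear_map_diff:
  assumes "linear_map g"
  shows "g (P - Q) = g P - g Q"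
  using linear_map_add[OF assms, of "P - Q" Q] by simp

text \<open>The determinantal criterion uses only linear operations and \<open>det\<close>, both
  respected by g; surjectivity writes an arbitrary test matrix Q as some \<open>g R\<close>.\<close>

lemma det_preserver_rank_le_one:
  assumes "det_preserver g" "rank_le_one P"
  shows "rank_le_one (g P)"
  unfolding rank_le_one_iff_det
proof
  fix Q
  obtain R where R: "Q = g R"
    using assms(1) by (metis bij_pointE det_preserver_def)
  have "det (Q + g P) + det (Q - g P) = det (R + P) + det (R - P)"
    using assms(1) unfolding R
    by (simp add: det_preserver_def flip: linear_map_add linear_map_diff)
  then show "det (Q + g P) + det (Q - g P) = 2 * det Q"
    using assms by (simp add: R rank_le_one_iff_det det_preserver_def)
qed

lemma rank_le_one_decompose:
  assumes "rank_le_one P"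
  obtains u v :: "3 \<Rightarrow> complex" where "\<And>i j. P $ i $ j = u i * v j"
proof (cases "P = 0")
  case True
  then show ?thesis using that[of "\<lambda>_. 0" "\<lambda>_. 0"] by simp
next
  case False
  then obtain k l where kl: "P $ k $ l \<noteq> 0" by (auto simp: vec_eq_iff)
  show ?thesis
  \<comment> \<open>A nonzero entry at \<open>(k, l)\<close> serves as pivot: column l times row k,
    the latter divided by the pivot.\<close>
  proof (rule that[of "\<lambda>i. P $ i $ l" "\<lambda>j. P $ k $ j / P $ k $ l"])
    fix i j
    show "P $ i $ j = P $ i $ l * (P $ k $ j / P $ k $ l)"
      using assms kl by (simp add: rank_le_one_def nonzero_eq_divide_eq)
  qed
qed

lemma rank_le_one_unit_matrix: "rank_le_one (unit_matrix i j)"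
  by (auto simp: rank_le_one_def)

section \<open>Two-sided multiplications as determinant preservers\<close>

lemma matrix_add_rdistrib: "(A + B) ** C = A ** C + B ** C" for A B C :: "complex^3^3"
  by (simp add: vec_eq_iff matrix_mult_3_nth sum.distrib algebra_simps)

lemma linear_map_mult: "linear_map (\<lambda>P. A ** P ** B)"
  by (simp add: linear_map_def matrix_add_ldistrib matrix_add_rdistrib)
   (simp add: mat_commute[symmetric] matrix_mul_assoc)

lemma linear_map_comp: "linear_map g \<Longrightarrow> linear_map h \<Longrightarrow> linear_map (\<lambda>P. g (h P))"
  by (simp add: linear_map_def)

lemma det_preserver_mult:
  assumes "det A * det B = 1"
  shows "det_preserver (\<lambda>P. A ** P ** B)"
proof -
  have "det A \<noteq> 0" "det B \<noteq> 0" using assms by auto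
  then obtain A' B' where i: "A ** A' = mat 1" "A' ** A = mat 1" "B ** B' = mat 1" "B' ** B = mat 1"
    using invertible_det_nz invertible_def by metis
  have "A' ** (A ** P ** B) ** B' = P" "A ** (A' ** P ** B') ** B = P" for P
    using i by (metis matrix_mul_assoc matrix_mul_lid matrix_mul_rid)+
  then have "bij (\<lambda>P. A ** P ** B)"
    by (intro bij_betw_byWitness[where f' = "\<lambda>P. A' ** P ** B'"]) auto
  then show ?thesis
    using assms by (simp add: det_preserver_def linear_map_mult det_mul)
qed

lemma det_preserver_comp: "det_preserver g \<Longrightarrow> det_preserver h \<Longrightarrow> det_preserver (\<lambda>P. g (h P))"
  using bij_comp[of h g] by (simp add: det_preserver_def linear_map_comp comp_def)

lemma rank_le_oneD: "rank_le_one P \<Longrightarrow> P $ i $ j * P $ k $ l = P $ i $ l * P $ k $ j"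
  by (simp add: rank_le_one_def)

text \<open>
  Adding \<open>unit_matrix i i\<close> and using rank at most one shows that the image of \<open>unit_matrix i j\<close> is
  supported at \<open>(i, j)\<close> and \<open>(j, i)\<close>, where only one entry is nonzero; sums along rows and columns
  force the same choice for all \<open>i \<noteq> j\<close>, and the image of the all-ones matrix factorizes the scalars.
\<close>

lemma det_preserver_normalized:
  assumes g: "det_preserver g" and diag: "\<And>i. g (unit_matrix i i) = unit_matrix i i"
  obtains c d where
    "(\<forall>P i j. g P $ i $ j = c i * P $ i $ j * d j) \<or> (\<forall>P i j. g P $ i $ j = c i * P $ j $ i * d j)"
proof -
  have lin: "linear_map g" and inj: "inj g"
    using g by (auto simp: det_preserver_def bij_def)
  have rk: "rank_le_one (g P)" if "rank_le_one P" for P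
    using g that by (rule det_preserver_rank_le_one)
  let ?N = "\<lambda>i j. g (unit_matrix i j)"
  have N: "rank_le_one (?N i j)" for i j
    by (simp add: rk rank_le_one_unit_matrix)
  \<comment> \<open>Write N for the image. The minor relations of \<open>unit_matrix i i + N\<close>
    and of N through position \<open>(i, i)\<close> differ exactly by the entry of N at
    \<open>(k, l)\<close>, which therefore vanishes.\<close>
  have row: "?N i j $ k $ l = 0" if "i \<noteq> j" "k \<noteq> i" "l \<noteq> i" for i j k l
  proof -
    have "rank_le_one (unit_matrix i i + unit_matrix i j)"
      by (auto simp: rank_le_one_def)
    then have "rank_le_one (unit_matrix i i + ?N i j)"
      using rk lin diag by (metis linear_map_add)
    from rank_le_oneD[OF this, of i i k l] rank_le_oneD[OF N, of i j i i k l] that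
    show ?thesis by (simp add: algebra_simps)
  qed
  have col: "?N i j $ k $ l = 0" if "i \<noteq> j" "k \<noteq> j" "l \<noteq> j" for i j k l
  proof -
    have "rank_le_one (unit_matrix j j + unit_matrix i j)"
      by (auto simp: rank_le_one_def)
    then have "rank_le_one (unit_matrix j j + ?N i j)"
      using rk lin diag by (metis linear_map_add)
    from rank_le_oneD[OF this, of j j k l] rank_le_oneD[OF N, of i j j j k l] that
    show ?thesis by (simp add: algebra_simps)
  qed
  \<comment> \<open>\<open>a\<close> is the part of the image left in place, \<open>b\<close> the
    part moved to the transposed position.\<close>
  define a where "a i j = ?N i j $ i $ j" for i j
  define b where "b i j = ?N i j $ j $ i" for i j
  have Nij: "?N i j $ k $ l = (if k = i \<and> l = j then a i j else if k = j \<and> l = i then b i j else 0)"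
    for i j k l
    using row[of i j k l] col[of i j k l] diag[of i] by (cases "i = j") (auto simp: a_def b_def)
  have ab: "a i j * b i j = 0" if "i \<noteq> j" for i j
    using rank_le_oneD[OF N, of i j i j j i] that by (simp add: Nij)
  have nz: "a i j \<noteq> 0 \<or> b i j \<noteq> 0" for i j
  proof (rule ccontr)
    assume "\<not> ?thesis"
    then have "?N i j = g 0"
      by (simp add: vec_eq_iff Nij linear_map_zero[OF lin])
    then have "unit_matrix i j = 0" using inj by (simp add: inj_eq)
    then have "unit_matrix i j $ i $ j = 0" by simp
    then show False by simp
  qed
  \<comment> \<open>Two unit matrices in one row have a sum of rank one; if one stayed in place
    while the other was transposed, the image would have a nonzero 2 x 2 minor.\<close>
  have ab_row: "a i j * b i k = 0" if "i \<noteq> j" "i \<noteq> k" "j \<noteq> k" for i j k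
  proof -
    have "rank_le_one (unit_matrix i j + unit_matrix i k)"
      by (auto simp: rank_le_one_def)
    then have "rank_le_one (?N i j + ?N i k)"
      using rk lin by (metis linear_map_add)
    from rank_le_oneD[OF this, of i j k i] that show ?thesis by (simp add: Nij)
  qed
  have ab_col: "a j i * b k i = 0" if "i \<noteq> j" "i \<noteq> k" "j \<noteq> k" for i j k
  proof -
    have "rank_le_one (unit_matrix j i + unit_matrix k i)"
      by (auto simp: rank_le_one_def)
    then have "rank_le_one (?N j i + ?N k i)"
      using rk lin by (metis linear_map_add)
    from rank_le_oneD[OF this, of j i i k] that show ?thesis by (simp add: Nij)
  qed
  have aii: "a i i = 1" "b i i = 1" for i by (simp_all add: a_def b_def diag)
  define J :: "complex^3^3" where "J = (\<chi> i j. 1)"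
  have J: "rank_le_one (g J)" by (rule rk) (simp add: rank_le_one_def J_def)
  have nth: "g P $ k $ l =
      (if k = l then P $ k $ k else P $ k $ l * a k l + P $ l $ k * b l k)" for P k l
  proof -
    have "\<forall>k l. g P $ k $ l =
        (if k = l then P $ k $ k else P $ k $ l * a k l + P $ l $ k * b l k)"
      unfolding linear_map_nth[OF lin, of P] Nij sum_3 forall_3 by (simp add: aii)
    then show ?thesis by blast
  qed
  \<comment> \<open>The choice made at \<open>(1, 2)\<close> is propagated by alternating row and
    column comparisons through \<open>(1, 3)\<close>, \<open>(2, 3)\<close>, \<open>(2, 1)\<close>,
    \<open>(3, 1)\<close> and \<open>(3, 2)\<close>.\<close>
  have "(\<forall>i j. i \<noteq> j \<longrightarrow> b i j = 0) \<or> (\<forall>i j. i \<noteq> j \<longrightarrow> a i j = 0)"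
  proof (cases "a 1 2 = 0")
    case False
    have "b 1 2 = 0" using ab[of 1 2] False by simp
    moreover have 13: "b 1 3 = 0" using ab_row[of 1 2 3] False by simp
    moreover have "a 1 3 \<noteq> 0" using nz 13 by blast
    moreover from this have 23: "b 2 3 = 0" using ab_col[of 3 1 2] by simp
    moreover have "a 2 3 \<noteq> 0" using nz 23 by blast
    moreover from this have 21: "b 2 1 = 0" using ab_row[of 2 3 1] by simp
    moreover have "a 2 1 \<noteq> 0" using nz 21 by blast
    moreover from this have 31: "b 3 1 = 0" using ab_col[of 1 2 3] by simp
    moreover have "a 3 1 \<noteq> 0" using nz 31 by blast
    moreover from this have 32: "b 3 2 = 0" using ab_row[of 3 1 2] by simp
    ultimately show ?thesis by (auto simp: forall_3)
  next
    case True
    have "b 1 2 \<noteq> 0" using nz True by blast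
    moreover from this have 13: "a 1 3 = 0" using ab_row[of 1 3 2] by simp
    moreover have "b 1 3 \<noteq> 0" using nz 13 by blast
    moreover from this have 23: "a 2 3 = 0" using ab_col[of 3 2 1] by simp
    moreover have "b 2 3 \<noteq> 0" using nz 23 by blast
    moreover from this have 21: "a 2 1 = 0" using ab_row[of 2 1 3] by simp
    moreover have "b 2 1 \<noteq> 0" using nz 21 by blast
    moreover from this have 31: "a 3 1 = 0" using ab_col[of 1 3 2] by simp
    moreover have "b 3 1 \<noteq> 0" using nz 31 by blast
    moreover from this have 32: "a 3 2 = 0" using ab_row[of 3 2 1] by simp
    ultimately show ?thesis using True by (auto simp: forall_3)
  qed
  then show ?thesis
  proof
    assume b0: "\<forall>i j. i \<noteq> j \<longrightarrow> b i j = 0"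
    have gP: "g P $ i $ j = P $ i $ j * a i j" for P i j
      using b0 by (simp add: nth aii)
    have aij: "a i j = a i 1 * a 1 j" for i j
      using rank_le_oneD[OF J, of i j 1 1] by (simp add: gP aii J_def)
    have "g P $ i $ j = a i 1 * P $ i $ j * a 1 j" for P i j
      using gP[of P i j] aij[of i j] by (simp add: mult_ac)
    then show ?thesis using that[of "\<lambda>i. a i 1" "a 1"] by blast
  next
    assume a0: "\<forall>i j. i \<noteq> j \<longrightarrow> a i j = 0"
    have gP: "g P $ i $ j = P $ j $ i * b j i" for P i j
      using a0 by (simp add: nth aii)
    have bji: "b j i = b 1 i * b j 1" for i j
      using rank_le_oneD[OF J, of i j 1 1] by (simp add: gP aii J_def)
    have "g P $ i $ j = b 1 i * P $ j $ i * b j 1" for P i j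
      using gP[of P i j] bji[of j i] by (simp add: mult_ac)
    then show ?thesis using that[of "b 1" "\<lambda>i. b i 1"] by blast
  qed
qed

text \<open>A two-sided multiplication reduces g to a map fixing the diagonal unit matrices, where
  \<open>det_preserver_normalized\<close> applies; the diagonal matrices C and D absorb the
  remaining scalars.\<close>

theorem det_preserver_cases:
  assumes g: "det_preserver g"
  obtains U V where "det U * det V = 1"
    "(\<forall>P. g P = U ** P ** V) \<or> (\<forall>P. g P = U ** transpose P ** V)"
proof -
  have lin: "linear_map g" and gdet: "det (g P) = det P" for P
    using g by (auto simp: det_preserver_def)
  have "\<exists>u v. \<forall>a b. g (unit_matrix i i) $ a $ b = u a * v b" for i
    using det_preserver_rank_le_one[OF g rank_le_one_unit_matrix]
    by (metis rank_le_one_decompose)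
  then obtain u v where uv: "g (unit_matrix i i) $ a $ b = u i a * v i b" for i a b
    by metis
  \<comment> \<open>The rank-one factors of the images of the diagonal unit matrices become the
    columns of U and the rows of V.\<close>
  define U V :: "complex^3^3" where "U = (\<chi> a i. u i a)" and "V = (\<chi> i b. v i b)"
  have UV: "g (unit_matrix i i) = U ** unit_matrix i i ** V" for i
    using exhaust_3[of i]
    by (auto simp: vec_eq_iff uv U_def V_def matrix_mult_3_nth sum_3)
  have m1: "mat 1 = (unit_matrix 1 1 + unit_matrix 2 2 + unit_matrix 3 3 :: complex^3^3)"
    by (simp add: vec_eq_iff forall_3 mat_def)
  \<comment> \<open>Summing over the diagonal, the identity goes to U times V; its image has
    determinant 1, so both factors are invertible.\<close>
  have "g (mat 1) = U ** mat 1 ** V"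
    by (simp add: m1 linear_map_add[OF lin] UV matrix_add_ldistrib matrix_add_rdistrib)
  then have dUV: "det U * det V = 1"
    using gdet[of "mat 1"] by (simp add: det_mul)
  then have "det U \<noteq> 0" "det V \<noteq> 0" by auto
  then obtain U' V' where i: "U ** U' = mat 1" "U' ** U = mat 1" "V ** V' = mat 1" "V' ** V = mat 1"
    using invertible_det_nz invertible_def by metis
  have dUV': "det U' * det V' = 1"
  proof -
    have "det U * det U' = 1" "det V * det V' = 1"
      using i by (metis det_mul det_I)+
    then have "det U' * det V' * (det U * det V) = 1" by (simp add: algebra_simps)
    then show ?thesis using dUV by simp
  qed
  define h where "h P = U' ** g P ** V'" for P
  have gh: "g P = U ** h P ** V" for P
    unfolding h_def using i by (metis matrix_mul_assoc matrix_mul_lid matrix_mul_rid)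
  have "det_preserver h"
    unfolding h_def by (intro det_preserver_comp[OF det_preserver_mult g] dUV')
  moreover have "h (unit_matrix k k) = unit_matrix k k" for k
    unfolding h_def UV using i by (metis matrix_mul_assoc matrix_mul_lid matrix_mul_rid)
  ultimately obtain c d where
    cd: "(\<forall>P i j. h P $ i $ j = c i * P $ i $ j * d j) \<or> (\<forall>P i j. h P $ i $ j = c i * P $ j $ i * d j)"
    by (rule det_preserver_normalized)
  define C D :: "complex^3^3" where
    "C = (\<chi> i j. if i = j then c i else 0)" and "D = (\<chi> i j. if i = j then d i else 0)"
  have CD: "(C ** P ** D) $ i $ j = c i * P $ i $ j * d j" for P i j
    using exhaust_3[of i] exhaust_3[of j]
    by (auto simp: C_def D_def matrix_mult_3_nth sum_3)
  have "(\<forall>P. h P = C ** P ** D) \<or> (\<forall>P. h P = C ** transpose P ** D)"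
    using cd by (simp add: vec_eq_iff CD transpose_def)
  then have *: "(\<forall>P. g P = (U ** C) ** P ** (D ** V)) \<or> (\<forall>P. g P = (U ** C) ** transpose P ** (D ** V))"
    by (metis gh matrix_mul_assoc)
  have "g (mat 1) = (U ** C) ** (D ** V)"
    using * by (auto simp: transpose_mat)
  then have "det (U ** C) * det (D ** V) = 1"
    using gdet[of "mat 1"] by (simp add: det_mul)
  then show ?thesis using * that by blast
qed


section \<open>Preservers of the determinant and the Hermitian form\<close>

abbreviation ctranspose :: "complex^3^3 \<Rightarrow> complex^3^3" where
  "ctranspose A \<equiv> transpose (map_matrix cnj A)"

text \<open>The form \<open>Jherm\<close> in matrix coordinates: conjugation by \<open>I1\<close> is
  \<open>Jsigma\<close> and \<open>ctranspose\<close> is \<open>Jtau\<close>.\<close>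

definition herm :: "complex^3^3 \<Rightarrow> complex^3^3 \<Rightarrow> complex" where
  "herm P Q = trace (I1 ** ctranspose P ** I1 ** Q)"

definition form_preserver :: "(complex^3^3 \<Rightarrow> complex^3^3) \<Rightarrow> bool" where
  "form_preserver g \<longleftrightarrow> det_preserver g \<and> (\<forall>P Q. herm (g P) (g Q) = herm P Q)"

lemma ctranspose_mult: "ctranspose (A ** B) = ctranspose B ** ctranspose A"
  by (simp add: cnj_matrix_mult matrix_transpose_mul)

lemma ctranspose_ctranspose [simp]: "ctranspose (ctranspose A) = A"
  by (simp add: vec_eq_iff transpose_def)

lemma ctranspose_mat [simp]: "ctranspose (mat c) = mat (cnj c)"
  by (simp add: vec_eq_iff transpose_def mat_def)

lemma ctranspose_I1 [simp]: "ctranspose I1 = I1"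
  by (simp add: cnj_matrix_I1 transpose_I1)

lemma ctranspose_unit_matrix [simp]: "ctranspose (unit_matrix i j) = unit_matrix j i"
  by (auto simp: vec_eq_iff transpose_def)

lemma det_cnj [simp]: "det (map_matrix cnj A :: complex^3^3) = cnj (det A)"
  by (simp add: det_3)

lemma det_mat [simp]: "det (mat c :: complex^3^3) = c ^ 3"
  by (simp add: det_3 mat_def power3_eq_cube)

lemma det_I1 [simp]: "det (I1 :: complex^3^3) = - 1"
  by (simp add: det_3 I1_def)

text \<open>The hypothesis exhibits a right inverse of A, and for square matrices this is also a
  left inverse.\<close>

lemma unitary_ctranspose:
  assumes "A ** I1 ** ctranspose A = I1"
  shows "ctranspose A ** I1 ** A = I1"
proof -
  have "A ** (I1 ** ctranspose A ** I1) = mat 1"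
    using assms by (simp add: I1_I1 matrix_mul_assoc)
  then have "I1 ** ctranspose A ** I1 ** A = mat 1"
    by (simp add: matrix_left_right_inverse)
  then have "I1 ** (I1 ** ctranspose A ** I1 ** A) = I1" by simp
  then show ?thesis by (simp add: matrix_mul_assoc I1_I1)
qed

lemma SU12_iff: "A \<in> carrier SU12 \<longleftrightarrow> A ** I1 ** ctranspose A = I1 \<and> det A = 1"
  by (simp add: SU12_def)

lemma SU12_ctranspose_unitary: "A \<in> carrier SU12 \<Longrightarrow> ctranspose A ** I1 ** A = I1"
  by (simp add: SU12_iff unitary_ctranspose)

text \<open>Testing on unit matrices isolates a single product of entries, so an identity of traces
  becomes entrywise information on X and Y.\<close>

lemma trace_unit_matrix:
  "trace (X ** unit_matrix j i ** Y ** unit_matrix k l) = X $ l $ j * Y $ i $ k"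
  using exhaust_3[of i] exhaust_3[of j] exhaust_3[of k] exhaust_3[of l]
  by (auto simp: trace_def sum_3 matrix_mult_3_nth)

text \<open>Cyclicity of the trace carries V to the front and separates the contributions of U and V
  into two Gram matrices.\<close>

lemma herm_mult:
  "herm (U ** P ** V) (U ** Q ** V) =
    trace ((V ** I1 ** ctranspose V) ** ctranspose P ** (ctranspose U ** I1 ** U) ** Q)"
proof -
  have "herm (U ** P ** V) (U ** Q ** V) =
      trace ((I1 ** ctranspose V ** ctranspose P ** ctranspose U ** I1 ** U ** Q) ** V)"
    unfolding herm_def by (simp add: ctranspose_mult matrix_mul_assoc)
  also have "\<dots> = trace (V ** (I1 ** ctranspose V ** ctranspose P ** ctranspose U ** I1 ** U ** Q))"
    by (rule trace_mul_sym)
  finally show ?thesis by (simp add: matrix_mul_assoc)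
qed

lemma herm_mult_SU12:
  assumes "A \<in> carrier SU12" "B \<in> carrier SU12"
  shows "herm (A ** P ** ctranspose B) (A ** Q ** ctranspose B) = herm P Q"
  using assms by (simp add: herm_mult SU12_ctranspose_unitary) (simp add: herm_def)

lemma herm_transpose: "herm (transpose P) (transpose Q) = herm P Q"
  by (simp add: herm_def trace_def sum_3 matrix_mult_3_nth I1_def transpose_def)

lemma complex_cube_root: "\<exists>z. z ^ 3 = (w :: complex)"
proof (cases "w = 0")
  case False
  have "exp (Ln w / 3) ^ 3 = w"
    using False by (simp flip: exp_of_nat_mult)
  then show ?thesis ..
qed auto

text \<open>
  After normalizing \<open>det U = det V = 1\<close>, invariance of the form only says that the two Gram
  matrices are inverse real multiples of \<open>I1\<close>; the real factor is a cube root of \<open>1\<close> since the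
  size \<open>3\<close> is odd.
\<close>

lemma SU12_factorization:
  assumes dUV: "det U * det V = 1"
    and inv: "\<And>P Q. herm (U ** P ** V) (U ** Q ** V) = herm P Q"
  obtains A B where "A \<in> carrier SU12" "B \<in> carrier SU12" "\<And>P. U ** P ** V = A ** P ** ctranspose B"
proof -
  \<comment> \<open>Dividing U by a cube root of its determinant gives determinant 1; multiplying V
    by the same root compensates.\<close>
  obtain c where c: "c ^ 3 = det U" using complex_cube_root by blast
  have dU: "det U \<noteq> 0" using dUV by auto
  then have c0: "c \<noteq> 0" using c by auto
  define A where "A = mat (1 / c) ** U"
  define W where "W = mat c ** V"
  have UV: "U ** P ** V = A ** P ** W" for P
  proof -
    have "A ** P ** W = mat (1 / c) ** ((U ** P) ** mat c) ** V"
      unfolding A_def W_def by (simp add: matrix_mul_assoc)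
    also have "\<dots> = mat (1 / c) ** (mat c ** (U ** P)) ** V"
      by (simp only: mat_commute)
    also have "\<dots> = (mat (1 / c) ** mat c) ** (U ** P) ** V"
      by (simp only: matrix_mul_assoc)
    finally show ?thesis using c0 by (simp add: mat_mult_mat)
  qed
  have dA: "det A = 1" and dW: "det W = 1"
    using c c0 dU dUV by (simp_all add: A_def W_def det_mul power_divide)
  define F where "F = ctranspose A ** I1 ** A"
  define G where "G = W ** I1 ** ctranspose W"
  \<comment> \<open>Invariance on all pairs of unit matrices; fixing a nonzero entry of G makes F
    proportional to \<open>I1\<close>.\<close>
  have FG: "G $ l $ j * F $ i $ k = I1 $ l $ j * I1 $ i $ k" for i j k l
    using inv[of "unit_matrix i j" "unit_matrix k l"]
    unfolding UV herm_mult F_def[symmetric] G_def[symmetric]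
    by (simp add: trace_unit_matrix herm_def)
  have I11: "(I1 :: complex^3^3) $ 1 $ 1 = - 1" by (simp add: I1_def)
  define r where "r = - (F $ 1 $ 1)"
  have Gr: "G $ 1 $ 1 * r = - 1"
    using FG[of 1 1 1 1] by (simp add: r_def I11)
  have GF: "G $ 1 $ 1 * F $ i $ k = - (I1 $ i $ k)" for i k
    using FG[of 1 1 i k] by (simp add: I11)
  have "F $ i $ k = r * I1 $ i $ k" for i k
  proof -
    have "F $ i $ k = - (G $ 1 $ 1 * r) * F $ i $ k" by (simp add: Gr)
    also have "\<dots> = - r * (G $ 1 $ 1 * F $ i $ k)" by simp
    finally show ?thesis by (simp add: GF)
  qed
  then have F: "F = mat r ** I1" by (simp add: vec_eq_iff)
  have "det F = - 1" by (simp add: F_def det_mul dA)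
  then have r3: "r ^ 3 = 1" by (simp add: F det_mul)
  have "ctranspose F = F" unfolding F_def by (simp add: ctranspose_mult matrix_mul_assoc)
  then have "cnj (F $ 1 $ 1) = F $ 1 $ 1"
    by (metis (mono_tags, lifting) nth_map_matrix transpose_def vec_lambda_beta)
  then have "r \<in> \<real>" by (simp add: r_def Reals_cnj_iff)
  then obtain x where x: "r = of_real x" by (auto elim: Reals_cases)
  then have "x ^ 3 = 1" using r3 unfolding x by (simp flip: of_real_power)
  then have "x = 1" using odd_real_root_unique[of 3 x 1] by simp
  then have "r = 1" using x by simp
  then have FI: "F = I1" unfolding F by (simp only: matrix_mul_lid)
  have "G $ l $ j = I1 $ l $ j" for l j
    using FG[of l j 1 1] by (simp add: FI I11)
  then have GI: "G = I1" by (simp add: vec_eq_iff)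
  \<comment> \<open>\<open>unitary_ctranspose\<close> exchanges the two sides of the Gram condition;
    the conjugate transpose of W takes the role of B.\<close>
  have "A \<in> carrier SU12"
    using unitary_ctranspose[of "ctranspose A"] FI dA by (simp add: F_def SU12_iff)
  moreover have "ctranspose W \<in> carrier SU12"
    using unitary_ctranspose[of W] GI dW by (simp add: G_def SU12_iff)
  ultimately show ?thesis using UV by (intro that[of A "ctranspose W"]) auto
qed

section \<open>Classification of the preservers of both forms\<close>

lemma form_preserver_comp:
  "form_preserver g \<Longrightarrow> form_preserver h \<Longrightarrow> form_preserver (\<lambda>P. g (h P))"
  by (simp add: form_preserver_def det_preserver_comp)

lemma form_preserver_mult:
  assumes "A \<in> carrier SU12" "B \<in> carrier SU12"
  shows "form_preserver (\<lambda>P. A ** P ** ctranspose B)"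
  unfolding form_preserver_def
proof
  show "det_preserver (\<lambda>P. A ** P ** ctranspose B)"
    using assms by (intro det_preserver_mult) (simp add: SU12_iff)
  show "\<forall>P Q. herm (A ** P ** ctranspose B) (A ** Q ** ctranspose B) = herm P Q"
    using herm_mult_SU12[OF assms] by blast
qed

lemma form_preserver_transpose: "form_preserver transpose"
proof -
  have "linear_map transpose"
    by (simp add: linear_map_def vec_eq_iff transpose_def)
  moreover have "bij (transpose :: complex^3^3 \<Rightarrow> _)"
    by (intro bij_betw_byWitness[where f' = transpose]) auto
  ultimately show ?thesis
    by (simp add: form_preserver_def det_preserver_def herm_transpose)
qed

theorem form_preserver_cases:
  assumes g: "form_preserver g"
  obtains A B where "A \<in> carrier SU12" "B \<in> carrier SU12"
    "g = (\<lambda>P. A ** P ** ctranspose B) \<or> g = (\<lambda>P. A ** transpose P ** ctranspose B)"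
proof -
  have h: "herm (g P) (g Q) = herm P Q" for P Q
    using g by (simp add: form_preserver_def)
  obtain U V where UV: "det U * det V = 1"
    and *: "(\<forall>P. g P = U ** P ** V) \<or> (\<forall>P. g P = U ** transpose P ** V)"
    using g det_preserver_cases by (metis form_preserver_def)
  \<comment> \<open>In the transposed case the invariance of g is applied to transposes and
    \<open>herm_transpose\<close> removes them again, so both cases reduce to the same map.\<close>
  have "herm (U ** P ** V) (U ** Q ** V) = herm P Q" for P Q
    using * h[of P Q] h[of "transpose P" "transpose Q"] by (auto simp: herm_transpose)
  then obtain A B where "A \<in> carrier SU12" "B \<in> carrier SU12"
    "\<And>P. U ** P ** V = A ** P ** ctranspose B"
    using SU12_factorization[OF UV] by blast
  with * that show ?thesis by (auto simp: fun_eq_iff)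
qed

section \<open>Pairs acting trivially, and the exclusion of transposition\<close>

lemma mult_eq_id_imp_Z3:
  assumes w: "w ^ 3 = 1" "w \<noteq> 1" and AB: "A \<in> carrier SU12" "B \<in> carrier SU12"
    and id: "\<And>P. A ** P ** ctranspose B = P"
  shows "(A, B) \<in> Z3 w"
proof -
  \<comment> \<open>The images of unit matrices show that the entries of A and of the conjugate of B
    multiply like those of two identity matrices; this forces A and B to be scalar.\<close>
  have e: "A $ i $ k * cnj (B $ j $ l) = (if i = k \<and> j = l then 1 else 0)" for i j k l
  proof -
    have "A $ i $ k * cnj (B $ j $ l) = (A ** unit_matrix k l ** ctranspose B) $ i $ j"
      using exhaust_3[of k] exhaust_3[of l]
      by (auto simp: matrix_mult_3_nth sum_3 transpose_def)
    then show ?thesis by (simp add: id)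
  qed
  define a b where "a = A $ 1 $ 1" and "b = B $ 1 $ 1"
  have ab: "a * cnj b = 1" using e[of 1 1 1 1] by (simp add: a_def b_def)
  then have ab0: "a \<noteq> 0" "b \<noteq> 0" by auto
  have "A $ i $ k * cnj b = (if i = k then a else 0) * cnj b" for i k
    using e[of i k 1 1] ab by (simp add: b_def)
  then have A: "A = mat a" using ab0 by (auto simp: vec_eq_iff mat_def)
  have "a * cnj (B $ j $ l) = a * cnj (if j = l then b else 0)" for j l
    using e[of 1 1 j l] ab by (simp add: a_def)
  then have B: "B = mat b" using ab0 by (auto simp: vec_eq_iff mat_def split: if_splits)
  have a3: "a ^ 3 = 1" using AB by (simp add: SU12_iff A)
  then have "norm a = 1" by (metis power_eq_1_iff zero_neq_numeral)
  then have "a * cnj a = 1" by (simp add: complex_norm_square[symmetric])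
  then have "cnj a = cnj b" using ab ab0 by (metis mult_left_cancel)
  then have b: "b = a" by simp
  \<comment> \<open>As w is not 1, it is a root of the cyclotomic factor, so the cube roots of unity
    are 1, w and the square of w.\<close>
  have "(w - 1) * (w\<^sup>2 + w + 1) = 0"
    using w(1) by (simp add: power2_eq_square power3_eq_cube algebra_simps)
  then have "w\<^sup>2 + w + 1 = 0" using w(2) by simp
  then have w2: "w\<^sup>2 = - w - 1" by (simp add: eq_neg_iff_add_eq_0 algebra_simps)
  have "(a - 1) * (a - w) * (a - w\<^sup>2) = a ^ 3 - (1 + w + w\<^sup>2) * a\<^sup>2 + (w + w\<^sup>2 + w ^ 3) * a - w ^ 3"
    by (simp add: power2_eq_square power3_eq_cube algebra_simps)
  also have "\<dots> = 0" by (simp add: a3 w w2)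
  finally have "a = 1 \<or> a = w \<or> a = w\<^sup>2" by auto
  then show ?thesis by (auto simp: Z3_def A B b)
qed

text \<open>A pair of scalar matrices \<open>mat z\<close> multiplies P by \<open>z * cnj z\<close>,
  which is 1 for cube roots of unity.\<close>

lemma Z3_imp_mult_eq_id:
  assumes w: "w ^ 3 = 1" and "(A, B) \<in> Z3 w"
  shows "A ** P ** ctranspose B = P"
proof -
  have "norm w = 1" using w by (metis power_eq_1_iff zero_neq_numeral)
  then have "norm (w\<^sup>2) = 1" by (simp add: norm_power)
  have "mat z ** P ** ctranspose (mat z) = P" if "norm z = 1" for z
  proof -
    have "z * cnj z = 1" using that by (simp add: complex_norm_square[symmetric])
    moreover have "mat z ** P ** mat (cnj z) = mat (z * cnj z) ** P"
      by (metis mat_commute matrix_mul_assoc mat_mult_mat)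
    ultimately show ?thesis by simp
  qed
  from this[of 1] this[OF \<open>norm w = 1\<close>] this[OF \<open>norm (w\<^sup>2) = 1\<close>] show ?thesis
    using assms(2) by (auto simp: Z3_def)
qed

lemma transpose_neq_mult: "transpose \<noteq> (\<lambda>P. A ** P ** B :: complex^3^3)"
proof
  assume *: "transpose = (\<lambda>P. A ** P ** B :: complex^3^3)"
  have "A $ i $ k * B $ l $ j = (if i = l \<and> j = k then 1 else 0)" for i j k l
  proof -
    have "A $ i $ k * B $ l $ j = (A ** unit_matrix k l ** B) $ i $ j"
      using exhaust_3[of k] exhaust_3[of l]
      by (auto simp: matrix_mult_3_nth sum_3)
    also have "\<dots> = transpose (unit_matrix k l) $ i $ j" by (simp add: *)
    finally show ?thesis by (simp add: transpose_def)
  qed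
  \<comment> \<open>The first two instances make four entries nonzero; the third says that a product
    of two of them is zero.\<close>
  from this[of 1 1 1 1] this[of 1 2 1 2] this[of 1 1 1 2] show False by auto
qed


section \<open>Hermitian matrices as complex matrices\<close>

text \<open>The algebra homomorphism sending the bold unit to \<open>\<i>\<close>; paired with its
  composite with \<open>bconj\<close> it splits the tensor product into two copies of
  \<open>complex\<close>.\<close>

definition cpart :: "bicomplex \<Rightarrow> complex" where
  "cpart x = bre x + \<i> * bim x"

definition matrix_of_J3 :: "bicomplex^3^3 \<Rightarrow> complex^3^3" where
  "matrix_of_J3 = map_matrix cpart"

text \<open>Each entry x solves \<open>cpart x = P $ i $ j\<close> and
  \<open>cpart (bconj x) = P $ j $ i\<close>, since \<open>bconj x\<close> is the entry at the
  transposed position.\<close>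

definition J3_of_matrix :: "complex^3^3 \<Rightarrow> bicomplex^3^3" where
  "J3_of_matrix P =
    (\<chi> i j. Bicomplex ((P $ i $ j + P $ j $ i) / 2) ((P $ i $ j - P $ j $ i) / (2 * \<i>)))"

lemma cpart_simps [simp]:
  "cpart 0 = 0" "cpart 1 = 1" "cpart (of_C c) = c" "cpart (- x) = - cpart x"
  "cpart (x + y) = cpart x + cpart y" "cpart (x - y) = cpart x - cpart y"
  "cpart (x * y) = cpart x * cpart y" "cpart (btau x) = cnj (cpart (bconj x))"
  by (simp_all add: cpart_def bicomplex_ops algebra_simps)

lemma cpart_sum: "cpart (\<Sum>i\<in>S. f i) = (\<Sum>i\<in>S. cpart (f i))"
  by (induction S rule: infinite_finite_induct) simp_all

lemma bicomplex_eqI: "cpart x = cpart y \<Longrightarrow> cpart (bconj x) = cpart (bconj y) \<Longrightarrow> x = y"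
proof -
  have *: "bre z = (cpart z + cpart (bconj z)) / 2" "bim z = (cpart z - cpart (bconj z)) / (2 * \<i>)" for z
    by (simp_all add: cpart_def bconj_def field_simps)
  assume "cpart x = cpart y" "cpart (bconj x) = cpart (bconj y)"
  then show "x = y" by (intro bicomplex.expand) (simp only: *)
qed

text \<open>\<open>cpart\<close> is a left inverse of \<open>of_C\<close>; this brings identities of
  the scalar-valued forms back from the matrix model.\<close>

lemma scalar_cpart_inject:
  "x \<in> range of_C \<Longrightarrow> y \<in> range of_C \<Longrightarrow> cpart x = cpart y \<longleftrightarrow> x = y"
  by auto

lemma J3_nth: "X \<in> J3 \<Longrightarrow> bconj (X $ i $ j) = X $ j $ i"
  by (simp add: J3_iff)

lemma J3_of_matrix_mem [simp]: "J3_of_matrix P \<in> J3"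
proof -
  have "- ((a - b) / c) = (b - a) / c" for a b c :: complex
    by (metis minus_diff_eq minus_divide_left)
  then show ?thesis
    by (simp only: J3_iff J3_of_matrix_def bconj_def vec_lambda_beta bicomplex.sel add.commute simp_thms)
qed

lemma matrix_of_J3_of_matrix [simp]: "matrix_of_J3 (J3_of_matrix P) = P"
  by (simp add: vec_eq_iff matrix_of_J3_def J3_of_matrix_def cpart_def field_simps)

lemma matrix_of_J3_inject:
  assumes "X \<in> J3" "Y \<in> J3" "matrix_of_J3 X = matrix_of_J3 Y"
  shows "X = Y"
proof -
  have e: "cpart (X $ i $ j) = cpart (Y $ i $ j)" for i j
    using assms(3) by (simp add: matrix_of_J3_def vec_eq_iff)
  have "X $ i $ j = Y $ i $ j" for i j
    by (rule bicomplex_eqI) (simp_all add: e J3_nth assms)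
  then show ?thesis by (simp add: vec_eq_iff)
qed

lemma J3_of_matrix_of_J3 [simp]: "X \<in> J3 \<Longrightarrow> J3_of_matrix (matrix_of_J3 X) = X"
  by (rule matrix_of_J3_inject) simp_all

lemma matrix_of_J3_add: "matrix_of_J3 (X + Y) = matrix_of_J3 X + matrix_of_J3 Y"
  by (simp add: matrix_of_J3_def vec_eq_iff)

lemma matrix_of_J3_hscale: "matrix_of_J3 (hscale c X) = mat c ** matrix_of_J3 X"
  by (simp add: matrix_of_J3_def hscale_def vec_eq_iff)

lemma matrix_of_J3_mult: "matrix_of_J3 (X ** Y) = matrix_of_J3 X ** matrix_of_J3 Y"
  by (simp add: matrix_of_J3_def matrix_matrix_mult_def vec_eq_iff cpart_sum)

lemma matrix_of_J3_I1: "matrix_of_J3 I1 = I1"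
  by (simp add: matrix_of_J3_def I1_def vec_eq_iff)

lemma cpart_trace: "cpart (trace X) = trace (matrix_of_J3 X)"
  by (simp add: trace_def matrix_of_J3_def cpart_sum)

text \<open>\<open>cpart\<close> turns \<open>btau\<close> into complex conjugation after
  \<open>bconj\<close>, and on Hermitian matrices \<open>bconj\<close> moves an entry to the
  transposed position.\<close>

lemma matrix_of_J3_Jtau: "X \<in> J3 \<Longrightarrow> matrix_of_J3 (Jtau X) = ctranspose (matrix_of_J3 X)"
  by (simp add: matrix_of_J3_def Jtau_def vec_eq_iff transpose_def J3_nth)

text \<open>The conjugates in \<open>Jdet\<close> are the entries at transposed positions, which
  turns its six terms into the Leibniz expansion.\<close>

lemma cpart_Jdet:
  assumes "X \<in> J3"
  shows "cpart (Jdet X) = det (matrix_of_J3 X)"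
  by (simp add: Jdet_def Let_def det_3 matrix_of_J3_def J3_nth[OF assms] algebra_simps)

lemma cpart_Jinner: "cpart (Jinner X Y) = trace (matrix_of_J3 X ** matrix_of_J3 Y)"
proof -
  let ?P = "matrix_of_J3 X" and ?Q = "matrix_of_J3 Y"
  have "trace (mat (1 / 2) ** (?P ** ?Q + ?Q ** ?P)) = (trace (?P ** ?Q) + trace (?Q ** ?P)) / 2"
    by (simp add: trace_def sum_3 algebra_simps)
  then show ?thesis
    by (simp add: Jinner_def cpart_trace matrix_of_J3_hscale matrix_of_J3_add matrix_of_J3_mult
        trace_mul_sym[of ?Q ?P])
qed

lemma cpart_Jherm:
  assumes "X \<in> J3"
  shows "cpart (Jherm X Y) = herm (matrix_of_J3 X) (matrix_of_J3 Y)"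
proof -
  have "matrix_of_J3 (Jtau (Jsigma X)) = ctranspose (I1 ** matrix_of_J3 X ** I1)"
    using assms
    by (simp add: matrix_of_J3_Jtau Jsigma_J3) (simp add: Jsigma_def matrix_of_J3_mult matrix_of_J3_I1)
  then show ?thesis
    by (simp add: Jherm_def cpart_Jinner herm_def ctranspose_mult matrix_mul_assoc)
qed

section \<open>Transport of preservers to the Jordan algebra\<close>

definition J3_map :: "(complex^3^3 \<Rightarrow> complex^3^3) \<Rightarrow> bicomplex^3^3 \<Rightarrow> bicomplex^3^3" where
  "J3_map g = (\<lambda>X \<in> J3. J3_of_matrix (g (matrix_of_J3 X)))"

lemma J3_map_apply: "X \<in> J3 \<Longrightarrow> J3_map g X = J3_of_matrix (g (matrix_of_J3 X))"
  by (simp add: J3_map_def)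

lemma matrix_of_J3_map: "X \<in> J3 \<Longrightarrow> matrix_of_J3 (J3_map g X) = g (matrix_of_J3 X)"
  by (simp add: J3_map_apply)

lemma J3_map_inject: "J3_map g = J3_map h \<longleftrightarrow> g = h"
proof
  assume e: "J3_map g = J3_map h"
  have "g P = h P" for P
    using matrix_of_J3_map[of "J3_of_matrix P" g] matrix_of_J3_map[of "J3_of_matrix P" h]
    by (simp add: e)
  then show "g = h" by blast
qed simp

lemma E6_m14_C_iff:
  "\<alpha> \<in> carrier E6_m14_C \<longleftrightarrow> \<alpha> \<in> Bij J3 \<and>
    (\<forall>X\<in>J3. \<forall>Y\<in>J3. \<alpha> (X + Y) = \<alpha> X + \<alpha> Y) \<and>
    (\<forall>c. \<forall>X\<in>J3. \<alpha> (hscale c X) = hscale c (\<alpha> X)) \<and>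
    (\<forall>X\<in>J3. Jdet (\<alpha> X) = Jdet X) \<and>
    (\<forall>X\<in>J3. \<forall>Y\<in>J3. Jherm (\<alpha> X) (\<alpha> Y) = Jherm X Y)"
  by (auto simp: E6_m14_C_def IsoC_J3_def)

lemma Jherm_scalar: "X \<in> J3 \<Longrightarrow> Y \<in> J3 \<Longrightarrow> Jherm X Y \<in> range of_C"
  by (simp add: Jherm_def Jinner_scalar Jtau_J3 Jsigma_J3)

lemma J3_map_mem:
  assumes g: "form_preserver g"
  shows "J3_map g \<in> carrier E6_m14_C"
proof -
  have lin: "linear_map g" and bij: "bij g" and dt: "\<And>P. det (g P) = det P"
    and hm: "\<And>P Q. herm (g P) (g Q) = herm P Q"
    using g by (auto simp: form_preserver_def det_preserver_def)
  have J: "J3_map g X \<in> J3" if "X \<in> J3" for X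
    using that by (simp add: J3_map_apply)
  have "bij_betw (J3_map g) J3 J3"
    using bij
    by (intro bij_betw_byWitness[where f' = "J3_map (inv_into UNIV g)"])
      (auto simp: J3_map_apply bij_is_inj bij_is_surj surj_f_inv_f)
  then have "J3_map g \<in> Bij J3" by (simp add: Bij_def J3_map_def)
  moreover have "J3_map g (X + Y) = J3_map g X + J3_map g Y" if "X \<in> J3" "Y \<in> J3" for X Y
    using that
    by (intro matrix_of_J3_inject)
      (simp_all add: J J3_add matrix_of_J3_add matrix_of_J3_map linear_map_add[OF lin])
  moreover have "J3_map g (hscale c X) = hscale c (J3_map g X)" if "X \<in> J3" for c X
    using that
    by (intro matrix_of_J3_inject)
      (simp_all add: J J3_hscale matrix_of_J3_hscale matrix_of_J3_map linear_map_scale[OF lin])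
  moreover have "Jdet (J3_map g X) = Jdet X" if "X \<in> J3" for X
    using that J[OF that]
    by (intro scalar_cpart_inject[THEN iffD1] Jdet_scalar) (simp_all add: cpart_Jdet matrix_of_J3_map dt)
  moreover have "Jherm (J3_map g X) (J3_map g Y) = Jherm X Y" if "X \<in> J3" "Y \<in> J3" for X Y
    using that J
    by (intro scalar_cpart_inject[THEN iffD1] Jherm_scalar) (simp_all add: cpart_Jherm matrix_of_J3_map hm)
  ultimately show ?thesis by (simp add: E6_m14_C_iff)
qed

lemma E6_m14_C_J3_map:
  assumes a: "\<alpha> \<in> carrier E6_m14_C"
  obtains g where "form_preserver g" "\<alpha> = J3_map g"
proof -
  have ab: "bij_betw \<alpha> J3 J3" and ext: "\<alpha> \<in> extensional J3"
    and add: "\<And>X Y. X \<in> J3 \<Longrightarrow> Y \<in> J3 \<Longrightarrow> \<alpha> (X + Y) = \<alpha> X + \<alpha> Y"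
    and scale: "\<And>c X. X \<in> J3 \<Longrightarrow> \<alpha> (hscale c X) = hscale c (\<alpha> X)"
    and dt: "\<And>X. X \<in> J3 \<Longrightarrow> Jdet (\<alpha> X) = Jdet X"
    and hm: "\<And>X Y. X \<in> J3 \<Longrightarrow> Y \<in> J3 \<Longrightarrow> Jherm (\<alpha> X) (\<alpha> Y) = Jherm X Y"
    using a by (auto simp: E6_m14_C_iff Bij_def)
  have J: "\<alpha> X \<in> J3" if "X \<in> J3" for X
    using ab that by (rule bij_betwE[rule_format])
  define g where "g P = matrix_of_J3 (\<alpha> (J3_of_matrix P))" for P
  have "J3_of_matrix (P + Q) = J3_of_matrix P + J3_of_matrix Q" for P Q
    by (rule matrix_of_J3_inject) (simp_all add: J3_add matrix_of_J3_add)
  moreover have "J3_of_matrix (mat c ** P) = hscale c (J3_of_matrix P)" for c P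
    by (rule matrix_of_J3_inject) (simp_all add: J3_hscale matrix_of_J3_hscale)
  ultimately have "linear_map g"
    by (simp add: linear_map_def g_def add scale matrix_of_J3_add matrix_of_J3_hscale)
  moreover have "bij g"
  proof (rule bij_betw_byWitness[where f' = "\<lambda>P. matrix_of_J3 (inv_into J3 \<alpha> (J3_of_matrix P))"])
    have i: "inv_into J3 \<alpha> X \<in> J3" if "X \<in> J3" for X
      using ab that by (metis bij_betw_def inv_into_into)
    show "\<forall>P\<in>UNIV. matrix_of_J3 (inv_into J3 \<alpha> (J3_of_matrix (g P))) = P"
      using ab by (simp add: g_def J bij_betw_inv_into_left)
    show "\<forall>P\<in>UNIV. g (matrix_of_J3 (inv_into J3 \<alpha> (J3_of_matrix P))) = P"
      using ab by (simp add: g_def i bij_betw_inv_into_right)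
  qed auto
  moreover have "det (g P) = det P" for P
    using dt[of "J3_of_matrix P"] by (simp add: g_def J flip: cpart_Jdet) (simp add: cpart_Jdet)
  moreover have "herm (g P) (g Q) = herm P Q" for P Q
    using hm[of "J3_of_matrix P" "J3_of_matrix Q"]
    by (simp add: g_def J flip: cpart_Jherm) (simp add: cpart_Jherm)
  ultimately have "form_preserver g" by (simp add: form_preserver_def det_preserver_def)
  moreover have "\<alpha> = J3_map g"
    using ext by (auto simp: fun_eq_iff J3_map_def g_def J extensional_def)
  ultimately show ?thesis using that by blast
qed

lemma E6_m14_C_mult:
  assumes "form_preserver g" "form_preserver h"
  shows "J3_map g \<otimes>\<^bsub>E6_m14_C\<^esub> J3_map h = J3_map (\<lambda>P. g (h P))"
proof -
  have "J3_map g \<in> Bij J3" "J3_map h \<in> Bij J3"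
    using assms J3_map_mem by (auto simp: E6_m14_C_iff)
  then show ?thesis
    by (auto simp: E6_m14_C_def BijGroup_def compose_def J3_map_def fun_eq_iff)
qed

lemma E6_m14_C_one: "\<one>\<^bsub>E6_m14_C\<^esub> = J3_map (\<lambda>P. P)"
  by (auto simp: E6_m14_C_def BijGroup_def J3_map_def fun_eq_iff)

section \<open>The group isomorphism\<close>

text \<open>Recognizes L as an internal semidirect product: the involution t lies outside the image
  of F, conjugation by t realizes \<open>\<phi> 1\<close>, and two cosets of the image cover
  L.\<close>

lemma semidirect_product_Z2_iso:
  assumes N: "group N" and L: "group L" and F: "F \<in> hom N L" "inj_on F (carrier N)"
    and t: "t \<in> carrier L" "t \<otimes>\<^bsub>L\<^esub> t = \<one>\<^bsub>L\<^esub>" "t \<notin> F ` carrier N"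
    and \<phi>0: "\<And>n. n \<in> carrier N \<Longrightarrow> \<phi> 0 n = n"
    and \<phi>1: "\<And>n. n \<in> carrier N \<Longrightarrow> \<phi> 1 n \<in> carrier N"
      "\<And>n. n \<in> carrier N \<Longrightarrow> F (\<phi> 1 n) = t \<otimes>\<^bsub>L\<^esub> F n \<otimes>\<^bsub>L\<^esub> t"
    and cover: "\<And>l. l \<in> carrier L \<Longrightarrow> \<exists>n\<in>carrier N. l = F n \<or> l = F n \<otimes>\<^bsub>L\<^esub> t"
  shows "semidirect_product N (integer_mod_group 2) \<phi> \<cong> L"
proof -
  interpret N: group N by fact
  interpret L: group L by fact
  let ?S = "semidirect_product N (integer_mod_group 2) \<phi>"
  let ?h = "\<lambda>(n, k::int). if k = 0 then F n else F n \<otimes>\<^bsub>L\<^esub> t"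
  have Fc: "F n \<in> carrier L" if "n \<in> carrier N" for n
    using F(1) that by (auto simp: hom_def)
  have Fm: "F (n \<otimes>\<^bsub>N\<^esub> m) = F n \<otimes>\<^bsub>L\<^esub> F m" if "n \<in> carrier N" "m \<in> carrier N" for n m
    using F(1) that by (auto simp: hom_def)
  have tt: "t \<otimes>\<^bsub>L\<^esub> (t \<otimes>\<^bsub>L\<^esub> x) = x" if "x \<in> carrier L" for x
    using that t by (simp flip: L.m_assoc)
  have Z: "carrier (integer_mod_group 2) = {0, 1}"
    by (auto simp: carrier_integer_mod_group)
  have S: "carrier ?S = carrier N \<times> {0, 1}"
    by (simp add: semidirect_product_def Z)
  \<comment> \<open>Such an equality would place t in the image of F; hence the two cosets are
    disjoint, and injectivity can be checked on each.\<close>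
  have Ft: "F n \<noteq> F m \<otimes>\<^bsub>L\<^esub> t" if "n \<in> carrier N" "m \<in> carrier N" for n m
  proof
    assume e: "F n = F m \<otimes>\<^bsub>L\<^esub> t"
    have "F (inv\<^bsub>N\<^esub> m \<otimes>\<^bsub>N\<^esub> n) = F (inv\<^bsub>N\<^esub> m) \<otimes>\<^bsub>L\<^esub> F m \<otimes>\<^bsub>L\<^esub> t"
      using that t by (simp add: Fm e Fc L.m_assoc)
    also have "\<dots> = F (inv\<^bsub>N\<^esub> m \<otimes>\<^bsub>N\<^esub> m) \<otimes>\<^bsub>L\<^esub> t"
      using that by (simp only: Fm N.inv_closed)
    also have "\<dots> = t"
      using that t hom_one[OF F(1) N L] by simp
    finally have "t = F (inv\<^bsub>N\<^esub> m \<otimes>\<^bsub>N\<^esub> n)" ..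
    then show False using t(3) that by blast
  qed
  have "?h \<in> hom ?S L"
  proof (rule homI)
    fix x y assume "x \<in> carrier ?S" "y \<in> carrier ?S"
    then obtain n k m l where x: "x = (n, k)" "y = (m, l)" "n \<in> carrier N" "m \<in> carrier N"
      "k \<in> {0, 1}" "l \<in> {0, 1}"
      by (auto simp: S)
    then show "?h (x \<otimes>\<^bsub>?S\<^esub> y) = ?h x \<otimes>\<^bsub>L\<^esub> ?h y"
      using t by (auto simp: semidirect_product_def \<phi>0 \<phi>1 Fm Fc L.m_assoc tt)
  qed (use t in \<open>auto simp: S Fc\<close>)
  moreover have "inj_on ?h (carrier ?S)"
  proof (rule inj_onI)
    fix x y assume "x \<in> carrier ?S" "y \<in> carrier ?S" "?h x = ?h y"
    then show "x = y"
      using F(2) t Ft Ft[symmetric] by (auto simp: S Fc dest: inj_onD)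
  qed
  moreover have "?h ` carrier ?S = carrier L"
  proof
    show "?h ` carrier ?S \<subseteq> carrier L" using t by (auto simp: S Fc)
    show "carrier L \<subseteq> ?h ` carrier ?S"
    proof
      fix l assume "l \<in> carrier L"
      then obtain n where "n \<in> carrier N" "l = F n \<or> l = F n \<otimes>\<^bsub>L\<^esub> t" using cover by blast
      then have "(n, 0) \<in> carrier ?S \<and> l = ?h (n, 0) \<or> (n, 1) \<in> carrier ?S \<and> l = ?h (n, 1)"
        by (auto simp: S)
      then show "l \<in> ?h ` carrier ?S" by blast
    qed
  qed
  ultimately have "?h \<in> iso ?S L" by (simp add: iso_def bij_betw_def)
  then show ?thesis by (rule is_isoI)
qed

section \<open>The action of pairs from SU(1,2)\<close>

definition SU12_action ::
    "(complex^3^3) \<times> (complex^3^3) \<Rightarrow> bicomplex^3^3 \<Rightarrow> bicomplex^3^3" where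
  "SU12_action = (\<lambda>(A, B). J3_map (\<lambda>P. A ** P ** ctranspose B))"

text \<open>\<open>ctranspose\<close> reverses products, which undoes the reversal caused by
  multiplying on the right.\<close>

lemma SU12_action_hom: "SU12_action \<in> hom (SU12 \<times>\<times> SU12) E6_m14_C"
proof (rule homI)
  fix x assume "x \<in> carrier (SU12 \<times>\<times> SU12)"
  then obtain A B where "x = (A, B)" "A \<in> carrier SU12" "B \<in> carrier SU12" by auto
  then show "SU12_action x \<in> carrier E6_m14_C"
    by (simp add: SU12_action_def J3_map_mem form_preserver_mult)
next
  fix x y assume "x \<in> carrier (SU12 \<times>\<times> SU12)" "y \<in> carrier (SU12 \<times>\<times> SU12)"
  then obtain A B C D where x: "x = (A, B)" "A \<in> carrier SU12" "B \<in> carrier SU12"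
    and y: "y = (C, D)" "C \<in> carrier SU12" "D \<in> carrier SU12" by auto
  have xy: "x \<otimes>\<^bsub>SU12 \<times>\<times> SU12\<^esub> y = (A ** C, B ** D)"
    by (simp add: x(1) y(1)) (simp add: SU12_def)
  show "SU12_action (x \<otimes>\<^bsub>SU12 \<times>\<times> SU12\<^esub> y) = SU12_action x \<otimes>\<^bsub>E6_m14_C\<^esub> SU12_action y"
    unfolding xy using x y
    by (simp add: SU12_action_def E6_m14_C_mult form_preserver_mult ctranspose_mult matrix_mul_assoc)
qed

lemma kernel_SU12_action:
  assumes w: "w ^ 3 = 1" "w \<noteq> 1"
  shows "kernel (SU12 \<times>\<times> SU12) E6_m14_C SU12_action = Z3 w"
proof -
  have sub: "Z3 w \<subseteq> carrier (SU12 \<times>\<times> SU12)"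
    using normal_imp_subgroup[OF Z3_normal[OF w(1)]] by (rule subgroup.subset)
  have trivial: "SU12_action (A, B) = \<one>\<^bsub>E6_m14_C\<^esub> \<longleftrightarrow> (\<forall>P. A ** P ** ctranspose B = P)" for A B
    unfolding SU12_action_def prod.case E6_m14_C_one J3_map_inject by (rule fun_eq_iff)
  have "(A, B) \<in> kernel (SU12 \<times>\<times> SU12) E6_m14_C SU12_action \<longleftrightarrow> (A, B) \<in> Z3 w" for A B
  proof
    assume "(A, B) \<in> kernel (SU12 \<times>\<times> SU12) E6_m14_C SU12_action"
    then have "A \<in> carrier SU12" "B \<in> carrier SU12" "\<forall>P. A ** P ** ctranspose B = P"
      unfolding kernel_def mem_Collect_eq trivial by auto
    then show "(A, B) \<in> Z3 w" by (intro mult_eq_id_imp_Z3[OF w]) blast+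
  next
    assume AB: "(A, B) \<in> Z3 w"
    then have "\<forall>P. A ** P ** ctranspose B = P"
      by (intro allI Z3_imp_mult_eq_id[OF w(1)])
    then show "(A, B) \<in> kernel (SU12 \<times>\<times> SU12) E6_m14_C SU12_action"
      unfolding kernel_def mem_Collect_eq trivial using sub AB by blast
  qed
  then show ?thesis by (simp only: set_eq_iff split_paired_All simp_thms)
qed

text \<open>Transposing the product of A, \<open>transpose P\<close> and \<open>ctranspose B\<close>
  gives the conjugate of B, then P, then \<open>transpose A\<close>, which is
  \<open>ctranspose\<close> of the conjugate of A.\<close>

lemma SU12_action_eps:
  assumes "x \<in> carrier (SU12 \<times>\<times> SU12)"
  shows "SU12_action (eps x) =
    J3_map transpose \<otimes>\<^bsub>E6_m14_C\<^esub> SU12_action x \<otimes>\<^bsub>E6_m14_C\<^esub> J3_map transpose"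
proof -
  obtain A B where x: "x = (A, B)" "A \<in> carrier SU12" "B \<in> carrier SU12"
    using assms by auto
  have fp: "form_preserver (\<lambda>P. transpose (A ** P ** ctranspose B))"
    by (intro form_preserver_comp[OF form_preserver_transpose] form_preserver_mult x)
  show ?thesis
    using x fp
    by (simp add: SU12_action_def E6_m14_C_mult form_preserver_mult form_preserver_transpose eps_def
        matrix_transpose_mul cnj_matrix_cnj_matrix matrix_mul_assoc)
qed

theorem theorem4p4p2:
  fixes \<omega> :: complex
  assumes "\<omega> ^ 3 = 1" and "\<omega> \<noteq> 1"
  shows "E6_m14_C \<cong>
    semidirect_product ((SU12 \<times>\<times> SU12) Mod Z3 \<omega>) (integer_mod_group 2) (eps_action \<omega>)"
proof -
  let ?G = "SU12 \<times>\<times> SU12" and ?t = "J3_map transpose"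
  let ?Q = "?G Mod Z3 \<omega>"
  let ?F = "\<lambda>S. the_elem (SU12_action ` S)"
  interpret G: group ?G by (intro DirProd_group group_SU12)
  interpret L: group E6_m14_C by (rule group_E6_m14_C)
  interpret f: group_hom ?G E6_m14_C SU12_action
    by unfold_locales (rule SU12_action_hom)
  note ker = kernel_SU12_action[OF assms]
  have Q: "group ?Q" using Z3_normal[OF assms(1)] by (rule normal.factorgroup_is_group)
  \<comment> \<open>The action is constant on cosets of its kernel, so \<open>the_elem\<close> picks
    the value of the induced map on the quotient.\<close>
  have img: "SU12_action ` S = {?F S}" "S \<noteq> {}" "S \<subseteq> carrier ?G" if "S \<in> carrier ?Q" for S
  proof -
    have "\<exists>x\<in>carrier ?G. S = Z3 \<omega> #>\<^bsub>?G\<^esub> x"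
      using that by (simp add: FactGroup_def RCOSETS_def del: carrier_DirProd)
    then obtain x where x: "x \<in> carrier ?G" "S = Z3 \<omega> #>\<^bsub>?G\<^esub> x" ..
    have sub: "Z3 \<omega> \<subseteq> carrier ?G" using ker by (auto simp: kernel_def)
    show "S \<subseteq> carrier ?G" unfolding x(2) using sub x(1) by (rule G.r_coset_subset_G)
    have const: "SU12_action (z \<otimes>\<^bsub>?G\<^esub> x) = SU12_action x" if "z \<in> Z3 \<omega>" for z
      using that x(1) sub by (simp add: kernel_def flip: ker del: carrier_DirProd)
    have ne: "Z3 \<omega> \<noteq> {}" by (simp add: Z3_def)
    have S: "S = (\<lambda>z. z \<otimes>\<^bsub>?G\<^esub> x) ` Z3 \<omega>" unfolding x(2) r_coset_def by blast
    have "SU12_action ` S = (\<lambda>_. SU12_action x) ` Z3 \<omega>"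
      unfolding S image_image by (intro image_cong refl const)
    then have "SU12_action ` S = {SU12_action x}" and "S \<noteq> {}"
      using ne S by (simp_all only: image_constant_conv image_is_empty if_False simp_thms)
    then show "SU12_action ` S = {?F S}" "S \<noteq> {}" by simp_all
  qed
  have "semidirect_product ?Q (integer_mod_group 2) (eps_action \<omega>) \<cong> E6_m14_C"
  proof (rule semidirect_product_Z2_iso[OF Q group_E6_m14_C])
    show "?F \<in> hom ?Q E6_m14_C" "inj_on ?F (carrier ?Q)"
      using f.FactGroup_hom f.FactGroup_inj_on by (simp_all add: ker)
    show "?t \<in> carrier E6_m14_C" by (intro J3_map_mem form_preserver_transpose)
    show "?t \<otimes>\<^bsub>E6_m14_C\<^esub> ?t = \<one>\<^bsub>E6_m14_C\<^esub>"
      by (simp add: E6_m14_C_mult form_preserver_transpose E6_m14_C_one)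
    show "?t \<notin> ?F ` carrier ?Q"
    proof
      assume "?t \<in> ?F ` carrier ?Q"
      then obtain S where "S \<in> carrier ?Q" "?t = ?F S" by blast
      then have "?t \<in> SU12_action ` S" using img(1) by blast
      then show False
        using transpose_neq_mult by (auto simp: SU12_action_def J3_map_inject)
    qed
  next
    fix S assume S: "S \<in> carrier ?Q"
    show "eps_action \<omega> 0 S = S" using S by (simp add: eps_action_def SU12_quot_def)
    have e1: "eps_action \<omega> 1 S = eps ` S" using S by (simp add: eps_action_def SU12_quot_def)
    have "eps_action \<omega> 1 \<in> carrier (AutoGroup ?Q)"
      using eps_action_hom[OF assms(1)]
      by (auto simp: hom_def SU12_quot_def carrier_integer_mod_group)
    then show "eps_action \<omega> 1 S \<in> carrier ?Q"
      using S by (auto simp: AutoGroup_def auto_def hom_def)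
    \<comment> \<open>The relation for single pairs, taken over a whole coset, descends to the
      quotient.\<close>
    have "SU12_action ` (eps ` S) =
        (\<lambda>x. ?t \<otimes>\<^bsub>E6_m14_C\<^esub> SU12_action x \<otimes>\<^bsub>E6_m14_C\<^esub> ?t) ` S"
      unfolding image_image using img(3)[OF S] by (intro image_cong refl SU12_action_eps) auto
    also have "\<dots> = (\<lambda>a. ?t \<otimes>\<^bsub>E6_m14_C\<^esub> a \<otimes>\<^bsub>E6_m14_C\<^esub> ?t) ` {?F S}"
      unfolding img(1)[OF S, symmetric] image_image ..
    finally show "?F (eps_action \<omega> 1 S) = ?t \<otimes>\<^bsub>E6_m14_C\<^esub> ?F S \<otimes>\<^bsub>E6_m14_C\<^esub> ?t"
      by (simp add: e1)
  next
    fix \<alpha> assume "\<alpha> \<in> carrier E6_m14_C"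
    then obtain g where g: "form_preserver g" "\<alpha> = J3_map g" by (rule E6_m14_C_J3_map)
    then obtain A B where AB: "A \<in> carrier SU12" "B \<in> carrier SU12"
      "g = (\<lambda>P. A ** P ** ctranspose B) \<or> g = (\<lambda>P. A ** transpose P ** ctranspose B)"
      by (auto elim: form_preserver_cases)
    \<comment> \<open>The coset of the classified pair is the witness; in the transposed case
      \<alpha> has the extra factor \<open>?t\<close>.\<close>
    let ?S = "Z3 \<omega> #>\<^bsub>?G\<^esub> (A, B)"
    have S: "?S \<in> carrier ?Q" using AB by (auto simp: FactGroup_def RCOSETS_def)
    have "(A, B) \<in> ?S"
      using AB by (intro G.rcos_self normal_imp_subgroup Z3_normal assms) simp
    then have "SU12_action (A, B) = ?F ?S" using img(1)[OF S] by blast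
    moreover have "\<alpha> = SU12_action (A, B) \<or> \<alpha> = SU12_action (A, B) \<otimes>\<^bsub>E6_m14_C\<^esub> ?t"
      using AB g
      by (auto simp: SU12_action_def E6_m14_C_mult form_preserver_mult form_preserver_transpose)
    ultimately show "\<exists>S\<in>carrier ?Q. \<alpha> = ?F S \<or> \<alpha> = ?F S \<otimes>\<^bsub>E6_m14_C\<^esub> ?t"
      using S by auto
  qed
  \<comment> \<open>Reversing the isomorphism requires its source to be a group, which rests on
    \<open>eps_action_hom\<close>.\<close>
  moreover have "group (semidirect_product ?Q (integer_mod_group 2) (eps_action \<omega>))"
    using Q eps_action_hom[OF assms(1)]
    by (intro group_semidirect_product) (simp_all add: SU12_quot_def)
  ultimately show ?thesis by (simp add: group.iso_sym)
qed

end
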